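(* Let $\gamma_0\colon\mathbb{S}^1\to\mathbb{R}^2$ be a smooth regular closed curve with signed enclosed area $A_0=\mathcal{A}(\gamma_0)=0$, and let $\lambda=0$. Let $\gamma\colon[0,\infty)\times\mathbb{S}^1\to\mathbb{R}^2$ be the (geometrically unique) global smooth solution of $$\partial_t^\perp\gamma=\nabla_s^2\Big(\nabla_s^2\kappa+\tfrac12|\kappa|^2\kappa\Big)\ \text{ in }(0,\infty)\times\mathbb{S}^1,\qquad\gamma(0,\cdot)=\gamma_0 .$$ Then the length $\mathcal{L}(\gamma(t))$ becomes unbounded as time goes to infinity, i.e. there is no $M\in\mathbb{R}$ with $\mathcal{L}(\gamma(t))<M$ for all $t\ge0$.
   Context: For a regular curve $\gamma\colon\mathbb{S}^1\to\mathbb{R}^2$ ($\partial_x\gamma\ne0$): $\partial_s=|\partial_x\gamma|^{-1}\partial_x$, $\mathrm{d}s=|\partial_x\gamma|\,\mathrm{d}x$, $\kappa=\partial_s^2\gamma$ is the curvature vector, $\nu$ is the counter-clockwise rotation of $\partial_s\gamma$ by $\pi/2$. For a vector field $\phi$ along $\gamma$, $P^\perp\phi=\phi-\langle\phi,\partial_s\gamma\rangle\partial_s\gamma$, $\nabla_s=P^\perp\partial_s$, $\partial_t^\perp=P^\perp\partial_t$; for time-dependent $\gamma$ these are taken for each $\gamma(t,\cdot)$, which is regular for every $t$. $\mathcal{L}(\gamma)=\int_{\mathbb{S}^1}\mathrm{d}s$ is the length and $\mathcal{A}(\gamma)=-\frac12\int_{\mathbb{S}^1}\langle\gamma,\nu\rangle\,\mathrm{d}s$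 the signed enclosed area. Geometric uniqueness means uniqueness up to (time-dependent) reparametrization; existence of this global solution is part of the theory. *)

theory Defs
  imports "HOL-Analysis.Analysis"
begin

text \<open>
  \<^term>\<open>S\<close> is meant to be a convex set with nonempty interior (possibly containing boundary
  points), so that the Frechet derivative within \<^term>\<open>S\<close> is unique. At boundary points
  the derivatives are one-sided, so smoothness on a closed half space is smoothness up to
  the boundary.
\<close>

primrec Ck_on :: "nat \<Rightarrow> 'a::euclidean_space set \<Rightarrow> ('a \<Rightarrow> 'b::real_normed_vector) \<Rightarrow> bool" where
  "Ck_on 0 S f \<longleftrightarrow> continuous_on S f"
| "Ck_on (Suc k) S f \<longleftrightarrow>
     f differentiable_on S \<and> (\<forall>v. Ck_on k S (\<lambda>x. frechet_derivative f (at x within S) v))"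

definition smooth_on :: "'a::euclidean_space set \<Rightarrow> ('a \<Rightarrow> 'b::real_normed_vector) \<Rightarrow> bool" where
  "smooth_on S f \<longleftrightarrow> (\<forall>k. Ck_on k S f)"

text \<open>
  The circle is identified with the quotient of the real line by multiples of \<open>2\<pi>\<close>: maps on
  the circle are \<open>2\<pi>\<close>-periodic maps on the real line, and integrals over the circle are
  integrals over \<open>[0, 2\<pi>]\<close>.
\<close>

definition closed_curve :: "(real \<Rightarrow> 'a) \<Rightarrow> bool" where
  "closed_curve c \<longleftrightarrow> (\<forall>x. c (x + 2 * pi) = c x)"

definition regular_curve :: "(real \<Rightarrow> real^2) \<Rightarrow> bool" where
  "regular_curve c \<longleftrightarrow> (\<forall>x. vector_derivative c (at x) \<noteq> 0)"

definition speed :: "(real \<Rightarrow> real^2) \<Rightarrow> real \<Rightarrow> real" where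
  "speed c x = norm (vector_derivative c (at x))"

definition arc_deriv :: "(real \<Rightarrow> real^2) \<Rightarrow> (real \<Rightarrow> real^2) \<Rightarrow> real \<Rightarrow> real^2" where
  "arc_deriv c \<phi> x = inverse (speed c x) *\<^sub>R vector_derivative \<phi> (at x)"

definition tangent :: "(real \<Rightarrow> real^2) \<Rightarrow> real \<Rightarrow> real^2" where
  "tangent c = arc_deriv c c"

definition curvature :: "(real \<Rightarrow> real^2) \<Rightarrow> real \<Rightarrow> real^2" where
  "curvature c = arc_deriv c (arc_deriv c c)"

definition rot90 :: "real^2 \<Rightarrow> real^2" where
  "rot90 v = vector [- (v $ 2), v $ 1]"

definition unit_normal :: "(real \<Rightarrow> real^2) \<Rightarrow> real \<Rightarrow> real^2" where
  "unit_normal c x = rot90 (tangent c x)"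

definition normal_proj :: "(real \<Rightarrow> real^2) \<Rightarrow> (real \<Rightarrow> real^2) \<Rightarrow> real \<Rightarrow> real^2" where
  "normal_proj c \<phi> x = \<phi> x - (\<phi> x \<bullet> tangent c x) *\<^sub>R tangent c x"

definition nabla_s :: "(real \<Rightarrow> real^2) \<Rightarrow> (real \<Rightarrow> real^2) \<Rightarrow> real \<Rightarrow> real^2" where
  "nabla_s c \<phi> = normal_proj c (arc_deriv c \<phi>)"

definition normal_velocity :: "(real \<Rightarrow> real \<Rightarrow> real^2) \<Rightarrow> real \<Rightarrow> real \<Rightarrow> real^2" where
  "normal_velocity \<gamma> t = normal_proj (\<gamma> t) (\<lambda>x. vector_derivative (\<lambda>\<tau>. \<gamma> \<tau> x) (at t))"

definition curve_length :: "(real \<Rightarrow> real^2) \<Rightarrow> real" where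
  "curve_length c = integral {0..2 * pi} (speed c)"

definition signed_area :: "(real \<Rightarrow> real^2) \<Rightarrow> real" where
  "signed_area c = - (1/2) * integral {0..2 * pi} (\<lambda>x. (c x \<bullet> unit_normal c x) * speed c x)"

end

theory Submission imports Defs
begin

text \<open>
  Write \<open>w\<close> for the scalar \<open>L\<^sup>2\<close> gradient \<open>k\<^sub>s\<^sub>s + k\<^sup>3/2\<close> of the elastic energy \<open>E = 1/2 \<integral> k\<^sup>2 ds\<close>,
  so that the flow has scalar normal velocity \<open>w\<^sub>s\<^sub>s\<close>. It preserves the signed area and satisfies
  \<open>E' = - D\<close> with \<open>D = \<integral> w\<^sub>s\<^sup>2 ds\<close>. Since \<open>E\<close> is homogeneous of degree \<open>-1\<close> under dilations,
  \<open>E = - \<integral> w \<langle>\<gamma> - p, \<nu>\<rangle> ds\<close> for every point \<open>p\<close>, and zero area allows one to replace \<open>w\<close> by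
  \<open>w - w(0)\<close>. If the length stays below \<open>M\<close>, this bounds \<open>E\<close> by a multiple of \<open>\<integral> |w\<^sub>s| ds\<close>, while \<open>E\<close> is
  bounded below because the tangent of a closed curve has to turn. Hence \<open>D\<close> is bounded below by a
  positive constant and \<open>E\<close> becomes negative in finite time, which is absurd.
\<close>

subsection \<open>Smooth functions of time and space\<close>

definition has_partials :: "(real \<Rightarrow> real \<Rightarrow> real) \<Rightarrow> (real \<Rightarrow> real \<Rightarrow> real) \<Rightarrow> (real \<Rightarrow> real \<Rightarrow> real) \<Rightarrow> bool" where
  "has_partials f a b \<longleftrightarrow>
     (\<forall>t>0. \<forall>x. ((\<lambda>\<tau>. f \<tau> x) has_real_derivative a t x) (at t) \<and>
                (f t has_real_derivative b t x) (at x))"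

text \<open>The partial derivatives are bound existentially instead of named by
  \<open>deriv\<close>, so that inductions on the order can supply explicit formulas for
  them.\<close>

primrec Ck2 :: "nat \<Rightarrow> (real \<Rightarrow> real \<Rightarrow> real) \<Rightarrow> bool" where
  "Ck2 0 f \<longleftrightarrow> continuous_on ({0<..} \<times> UNIV) (\<lambda>(t, x). f t x)"
| "Ck2 (Suc n) f \<longleftrightarrow> continuous_on ({0<..} \<times> UNIV) (\<lambda>(t, x). f t x) \<and>
     (\<exists>a b. has_partials f a b \<and> Ck2 n a \<and> Ck2 n b)"

text \<open>Only positive times matter here; the values for \<open>t \<le> 0\<close> are arbitrary.\<close>

definition smooth2 :: "(real \<Rightarrow> real \<Rightarrow> real) \<Rightarrow> bool" where
  "smooth2 f \<longleftrightarrow> (\<forall>n. Ck2 n f)"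

definition dt :: "(real \<Rightarrow> real \<Rightarrow> real) \<Rightarrow> real \<Rightarrow> real \<Rightarrow> real" where
  "dt f t x = deriv (\<lambda>\<tau>. f \<tau> x) t"

definition dx :: "(real \<Rightarrow> real \<Rightarrow> real) \<Rightarrow> real \<Rightarrow> real \<Rightarrow> real" where
  "dx f t x = deriv (f t) x"

lemma Ck2_continuous: "Ck2 n f \<Longrightarrow> continuous_on ({0<..} \<times> UNIV) (\<lambda>(t, x). f t x)"
  by (cases n) auto

lemma has_partialsI:
  assumes "\<And>t x. t > 0 \<Longrightarrow> ((\<lambda>\<tau>. f \<tau> x) has_real_derivative a t x) (at t)"
    and "\<And>t x. t > 0 \<Longrightarrow> (f t has_real_derivative b t x) (at x)"
  shows "has_partials f a b"
  unfolding has_partials_def by (intro allI impI conjI assms)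

lemma has_partialsD:
  assumes "has_partials f a b" "t > 0"
  shows "((\<lambda>\<tau>. f \<tau> x) has_real_derivative a t x) (at t)" "(f t has_real_derivative b t x) (at x)"
  using assms by (simp_all add: has_partials_def)

text \<open>Product-like rules for derivatives contain the differentiated functions themselves,
  which are then required at the lower order.\<close>

lemma Ck2_Suc_imp: "Ck2 (Suc n) f \<Longrightarrow> Ck2 n f"
proof (induction n arbitrary: f)
  case 0
  then show ?case by simp
next
  case (Suc n)
  from Suc.prems obtain a b where ab: "has_partials f a b" "Ck2 (Suc n) a" "Ck2 (Suc n) b"
    unfolding Ck2.simps(2)[of "Suc n"] by blast
  show ?case
    unfolding Ck2.simps(2)[of n]
    by (intro conjI exI[of _ a] exI[of _ b] Ck2_continuous[OF Suc.prems] ab(1) Suc.IH ab(2,3))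
qed

lemma Ck2_SucI:
  assumes "Ck2 n f" "Ck2 n a" "Ck2 n b"
    and "\<And>t x. t > 0 \<Longrightarrow> ((\<lambda>\<tau>. f \<tau> x) has_real_derivative a t x) (at t)"
    and "\<And>t x. t > 0 \<Longrightarrow> (f t has_real_derivative b t x) (at x)"
  shows "Ck2 (Suc n) f"
  unfolding Ck2.simps(2)
  by (intro conjI exI[of _ a] exI[of _ b] has_partialsI Ck2_continuous[OF assms(1)] assms(2-5))

lemma Ck2_SucE:
  assumes "Ck2 (Suc n) f"
  obtains a b where "Ck2 n a" "Ck2 n b" "Ck2 n f" "has_partials f a b"
  using assms Ck2_Suc_imp[OF assms] by auto

lemma eventually_nhds_pos: "(t::real) > 0 \<Longrightarrow> (\<And>\<tau>. \<tau> > 0 \<Longrightarrow> P \<tau>) \<Longrightarrow> eventually P (nhds t)"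
  by (rule eventually_mono[OF eventually_nhds_in_open[of "{0<..}" t]]) auto

text \<open>Positive times form an open set, so functions agreeing there agree near each such time
  and share their time derivatives.\<close>

lemma Ck2_cong:
  assumes "\<And>t x. t > 0 \<Longrightarrow> f t x = g t x" and "Ck2 n f"
  shows "Ck2 n g"
proof (cases n)
  case 0
  then show ?thesis
    unfolding 0 Ck2.simps by (intro continuous_on_eq[OF Ck2_continuous[OF assms(2)]]) (use assms(1) in auto)
next
  case (Suc m)
  with assms have "Ck2 (Suc m) f" by simp
  then obtain a b where ab: "Ck2 m a" "Ck2 m b" "has_partials f a b"
    by (rule Ck2_SucE)
  have "continuous_on ({0<..} \<times> UNIV) (\<lambda>(t, x). g t x)"
    by (rule continuous_on_eq[OF Ck2_continuous[OF assms(2)]]) (use assms(1) in auto)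
  moreover have "((\<lambda>\<tau>. g \<tau> x) has_real_derivative a t x) (at t)" if "t > 0" for t x
    using has_partialsD(1)[OF ab(3) that, of x]
    by (rule DERIV_cong_ev[OF refl eventually_nhds_pos[OF that] refl, THEN iffD1, rotated])
       (use assms(1) in auto)
  moreover have "(g t has_real_derivative b t x) (at x)" if "t > 0" for t x
  proof -
    have "f t = g t" using assms(1) that by auto
    with has_partialsD(2)[OF ab(3) that, of x] show ?thesis by simp
  qed
  ultimately show ?thesis
    unfolding Suc Ck2.simps(2) by (intro conjI exI[of _ a] exI[of _ b] has_partialsI ab(1,2)) simp_all
qed

section \<open>Closure under arithmetic operations\<close>

lemma Ck2_const: "Ck2 n (\<lambda>t x. c)"
proof (induction n arbitrary: c)
  case 0
  show ?case by (simp add: case_prod_unfold)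
next
  case (Suc n)
  show ?case
    by (rule Ck2_SucI[OF Suc[of c] Suc[of 0] Suc[of 0]]) (rule DERIV_const)+
qed

lemma Ck2_add:
  assumes "Ck2 n f" "Ck2 n g"
  shows "Ck2 n (\<lambda>t x. f t x + g t x)"
  using assms
proof (induction n arbitrary: f g)
  case 0
  then show ?case by (auto simp: case_prod_unfold intro!: continuous_intros)
next
  case (Suc n)
  obtain a b where f: "Ck2 n a" "Ck2 n b" "Ck2 n f" "has_partials f a b"
    by (rule Ck2_SucE[OF Suc.prems(1)])
  obtain c d where g: "Ck2 n c" "Ck2 n d" "Ck2 n g" "has_partials g c d"
    by (rule Ck2_SucE[OF Suc.prems(2)])
  show ?case
    by (rule Ck2_SucI[OF Suc.IH[OF f(3) g(3)] Suc.IH[OF f(1) g(1)] Suc.IH[OF f(2) g(2)]])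
       (intro DERIV_add has_partialsD[OF f(4)] has_partialsD[OF g(4)]; assumption)+
qed

lemma Ck2_mult:
  assumes "Ck2 n f" "Ck2 n g"
  shows "Ck2 n (\<lambda>t x. f t x * g t x)"
  using assms
proof (induction n arbitrary: f g)
  case 0
  then show ?case by (auto simp: case_prod_unfold intro!: continuous_intros)
next
  case (Suc n)
  obtain a b where f: "Ck2 n a" "Ck2 n b" "Ck2 n f" "has_partials f a b"
    by (rule Ck2_SucE[OF Suc.prems(1)])
  obtain c d where g: "Ck2 n c" "Ck2 n d" "Ck2 n g" "has_partials g c d"
    by (rule Ck2_SucE[OF Suc.prems(2)])
  show ?case
    by (rule Ck2_SucI[OF Suc.IH[OF f(3) g(3)]
          Ck2_add[OF Suc.IH[OF f(1) g(3)] Suc.IH[OF g(1) f(3)]]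
          Ck2_add[OF Suc.IH[OF f(2) g(3)] Suc.IH[OF g(2) f(3)]]])
       (intro DERIV_mult has_partialsD[OF f(4)] has_partialsD[OF g(4)]; assumption)+
qed

text \<open>The derivative of a reciprocal is a product of the reciprocal, taken twice, with a
  partial derivative, so the induction hypothesis covers it. \<open>Ck2_sqrt\<close> works alike,
  with the root itself in the denominator.\<close>

lemma Ck2_inverse:
  assumes "Ck2 n f" "\<And>t x. t > 0 \<Longrightarrow> f t x \<noteq> 0"
  shows "Ck2 n (\<lambda>t x. inverse (f t x))"
  using assms
proof (induction n arbitrary: f)
  case 0
  then show ?case by (auto simp: case_prod_unfold intro!: continuous_intros)
next
  case (Suc n)
  obtain a b where f: "Ck2 n a" "Ck2 n b" "Ck2 n f" "has_partials f a b"
    by (rule Ck2_SucE[OF Suc.prems(1)])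
  have i: "Ck2 n (\<lambda>t x. inverse (f t x))" by (rule Suc.IH[OF f(3) Suc.prems(2)])
  have d: "Ck2 n (\<lambda>t x. (- 1) * (inverse (f t x) * c t x * inverse (f t x)))" if "Ck2 n c" for c
    by (intro Ck2_mult Ck2_const i that)
  show ?case
    by (rule Ck2_SucI[OF i d[OF f(1)] d[OF f(2)]])
       (rule DERIV_inverse'[THEN DERIV_cong], rule has_partialsD[OF f(4)], assumption, erule Suc.prems(2), simp)+
qed

lemma Ck2_sqrt:
  assumes "Ck2 n f" "\<And>t x. t > 0 \<Longrightarrow> f t x > 0"
  shows "Ck2 n (\<lambda>t x. sqrt (f t x))"
  using assms
proof (induction n arbitrary: f)
  case 0
  then show ?case by (auto simp: case_prod_unfold intro!: continuous_intros)
next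
  case (Suc n)
  obtain a b where f: "Ck2 n a" "Ck2 n b" "Ck2 n f" "has_partials f a b"
    by (rule Ck2_SucE[OF Suc.prems(1)])
  have i: "Ck2 n (\<lambda>t x. sqrt (f t x))" by (rule Suc.IH[OF f(3) Suc.prems(2)])
  have "Ck2 n (\<lambda>t x. inverse (sqrt (f t x)))"
    by (rule Ck2_inverse[OF i]) (metis Suc.prems(2) less_irrefl real_sqrt_gt_zero)
  then have d: "Ck2 n (\<lambda>t x. (1/2) * (c t x * inverse (sqrt (f t x))))" if "Ck2 n c" for c
    by (intro Ck2_mult Ck2_const that)
  have s: "((\<lambda>z. sqrt (h z)) has_real_derivative (1/2) * (e * inverse (sqrt (h z)))) (at z)"
    if "(h has_real_derivative e) (at z)" "h z > 0" for h :: "real \<Rightarrow> real" and e z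
    using DERIV_chain2[OF DERIV_real_sqrt[OF that(2)] that(1)] by (simp add: field_simps)
  show ?case
    by (rule Ck2_SucI[OF i d[OF f(1)] d[OF f(2)]]) (rule s, rule has_partialsD[OF f(4)], assumption, erule Suc.prems(2))+
qed

named_theorems smooth_intros

lemma smooth2_const [smooth_intros]: "smooth2 (\<lambda>t x. c)"
  by (simp add: smooth2_def Ck2_const)

lemma smooth2_add [smooth_intros]: "smooth2 f \<Longrightarrow> smooth2 g \<Longrightarrow> smooth2 (\<lambda>t x. f t x + g t x)"
  by (simp add: smooth2_def Ck2_add)

lemma smooth2_mult [smooth_intros]: "smooth2 f \<Longrightarrow> smooth2 g \<Longrightarrow> smooth2 (\<lambda>t x. f t x * g t x)"
  by (simp add: smooth2_def Ck2_mult)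

lemma smooth2_minus [smooth_intros]: "smooth2 f \<Longrightarrow> smooth2 (\<lambda>t x. - f t x)"
  using smooth2_mult[OF smooth2_const[of "-1"]] by simp

lemma smooth2_diff [smooth_intros]: "smooth2 f \<Longrightarrow> smooth2 g \<Longrightarrow> smooth2 (\<lambda>t x. f t x - g t x)"
  using smooth2_add[OF _ smooth2_minus] by simp

lemma smooth2_power [smooth_intros]: "smooth2 f \<Longrightarrow> smooth2 (\<lambda>t x. f t x ^ n)"
  by (induction n) (auto intro: smooth_intros)

lemma smooth2_divide [smooth_intros]:
  "smooth2 f \<Longrightarrow> smooth2 g \<Longrightarrow> (\<And>t x. t > 0 \<Longrightarrow> g t x \<noteq> 0) \<Longrightarrow> smooth2 (\<lambda>t x. f t x / g t x)"
  by (simp add: smooth2_def divide_inverse Ck2_mult Ck2_inverse)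

lemma smooth2_sqrt:
  "smooth2 f \<Longrightarrow> (\<And>t x. t > 0 \<Longrightarrow> f t x > 0) \<Longrightarrow> smooth2 (\<lambda>t x. sqrt (f t x))"
  by (simp add: smooth2_def Ck2_sqrt)

lemma has_partials_dt_dx:
  assumes "has_partials f a b" "t > 0"
  shows "dt f t x = a t x" "dx f t x = b t x"
  using has_partialsD[OF assms] by (simp_all add: dt_def dx_def DERIV_imp_deriv)

lemma smooth2_has_partials:
  assumes "smooth2 f"
  shows "has_partials f (dt f) (dx f)"
proof -
  have "Ck2 (Suc 0) f" using assms unfolding smooth2_def by blast
  then obtain a b where ab: "has_partials f a b" by (rule Ck2_SucE)
  show ?thesis
    by (rule has_partialsI) (simp_all add: has_partials_dt_dx[OF ab] has_partialsD[OF ab])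
qed

lemma smooth2_has_dt:
  "smooth2 f \<Longrightarrow> t > 0 \<Longrightarrow> ((\<lambda>\<tau>. f \<tau> x) has_real_derivative dt f t x) (at t)"
  by (rule has_partialsD(1)[OF smooth2_has_partials])

lemma smooth2_has_dx:
  "smooth2 f \<Longrightarrow> t > 0 \<Longrightarrow> (f t has_real_derivative dx f t x) (at x)"
  by (rule has_partialsD(2)[OF smooth2_has_partials])

lemma smooth2_dt [smooth_intros]:
  assumes "smooth2 f"
  shows "smooth2 (dt f)"
  unfolding smooth2_def
proof
  fix n
  have "Ck2 (Suc n) f" using assms unfolding smooth2_def by blast
  then obtain a b where "Ck2 n a" and ab: "has_partials f a b" by (rule Ck2_SucE)
  then show "Ck2 n (dt f)"
    using Ck2_cong[of a "dt f" n] has_partials_dt_dx[OF ab] by simp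
qed

lemma smooth2_dx [smooth_intros]:
  assumes "smooth2 f"
  shows "smooth2 (dx f)"
  unfolding smooth2_def
proof
  fix n
  have "Ck2 (Suc n) f" using assms unfolding smooth2_def by blast
  then obtain a b where "Ck2 n b" and ab: "has_partials f a b" by (rule Ck2_SucE)
  then show "Ck2 n (dx f)"
    using Ck2_cong[of b "dx f" n] has_partials_dt_dx[OF ab] by simp
qed

section \<open>Integrals in space and symmetry of mixed derivatives\<close>

lemma smooth2_continuous: "smooth2 f \<Longrightarrow> continuous_on ({0<..} \<times> UNIV) (\<lambda>(t, x). f t x)"
  unfolding smooth2_def using Ck2_continuous by blast

lemma smooth2_continuous_slice: "smooth2 f \<Longrightarrow> t > 0 \<Longrightarrow> continuous_on A (f t)"
  by (intro continuous_at_imp_continuous_on ballI DERIV_isCont[OF smooth2_has_dx])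

lemma smooth2_integrable: "smooth2 f \<Longrightarrow> t > 0 \<Longrightarrow> f t integrable_on {a..b}"
  by (intro integrable_continuous_real smooth2_continuous_slice)

text \<open>The Leibniz rule is applied on the convex parameter set \<open>{0<..}\<close>; since
  this set is open, the derivative within it is the ordinary one.\<close>

lemma smooth2_integral_has_dt:
  assumes "smooth2 f" "t > 0"
  shows "((\<lambda>\<tau>. integral {a..b} (f \<tau>)) has_real_derivative integral {a..b} (dt f t)) (at t)"
proof -
  have "((\<lambda>\<tau>. integral (cbox a b) (f \<tau>)) has_real_derivative integral (cbox a b) (dt f t)) (at t within {0<..})"
  proof (rule leibniz_rule_field_derivative)
    show "((\<lambda>\<tau>. f \<tau> y) has_real_derivative dt f s y) (at s within {0<..})" if "s \<in> {0<..}" for s y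
      using smooth2_has_dt[OF assms(1), of s y] that by (simp add: has_field_derivative_at_within)
    show "f s integrable_on cbox a b" if "s \<in> {0<..}" for s
      using smooth2_integrable[OF assms(1)] that by simp
    show "continuous_on ({0<..} \<times> cbox a b) (\<lambda>(t, x). dt f t x)"
      using smooth2_continuous[OF smooth2_dt[OF assms(1)]] by (rule continuous_on_subset) auto
  qed (use assms in auto)
  then show ?thesis
    using assms at_within_open[of t "{0<..}"] by simp
qed

lemma smooth2_FTC:
  assumes "smooth2 f" "t > 0" "a \<le> b"
  shows "integral {a..b} (dx f t) = f t b - f t a"
proof (rule integral_unique[OF fundamental_theorem_of_calculus[OF assms(3)]])
  show "(f t has_vector_derivative dx f t x) (at x within {a..b})" for x
    using smooth2_has_dx[OF assms(1,2), of x]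
    by (rule has_vector_derivative_at_within[OF has_real_derivative_iff_has_vector_derivative[THEN iffD1]])
qed

text \<open>An increment of \<open>f\<close> in space is the integral of \<open>dx f\<close>.
  Differentiating it in time under the integral and then in the upper limit gives the claim.\<close>

lemma dx_dt_commute:
  assumes f: "smooth2 f" and t: "t > 0"
  shows "dx (dt f) t x = dt (dx f) t x"
proof -
  let ?g = "dt (dx f)"
  have g: "smooth2 ?g" using f by (intro smooth_intros)
  have eq: "dt f t y - dt f t (x - 1) = integral {x - 1..y} (?g t)" if y: "y \<ge> x - 1" for y
  proof -
    have "((\<lambda>\<tau>. f \<tau> y - f \<tau> (x - 1)) has_real_derivative dt f t y - dt f t (x - 1)) (at t)"
      by (intro DERIV_diff smooth2_has_dt f t)
    moreover have "((\<lambda>\<tau>. f \<tau> y - f \<tau> (x - 1)) has_real_derivative integral {x - 1..y} (?g t)) (at t)"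
      using smooth2_integral_has_dt[OF smooth2_dx[OF f] t, of "x - 1" y]
      by (rule DERIV_cong_ev[OF refl eventually_nhds_pos[OF t] refl, THEN iffD1, rotated])
         (use f y in \<open>auto simp: smooth2_FTC\<close>)
    ultimately show ?thesis by (rule DERIV_unique)
  qed
  \<comment> \<open>The lower limit \<open>x - 1\<close> puts \<open>x\<close> in the interior of
    the interval, so that the derivative there is two-sided.\<close>
  have "((\<lambda>y. integral {x - 1..y} (?g t)) has_real_derivative ?g t x) (at x within {x - 1..x + 1})"
    by (rule integral_has_real_derivative) (auto intro: smooth2_continuous_slice g t)
  then have "((\<lambda>y. integral {x - 1..y} (?g t)) has_real_derivative ?g t x) (at x)"
    using at_within_Icc_at[of "x - 1" x "x + 1"] by simp
  then have "((\<lambda>y. dt f t y - dt f t (x - 1)) has_real_derivative ?g t x) (at x)"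
  proof (rule DERIV_cong_ev[OF refl _ refl, THEN iffD1, rotated])
    have "eventually (\<lambda>y. y \<in> {x - 1<..}) (nhds x)"
      by (rule eventually_nhds_in_open) auto
    then show "\<forall>\<^sub>F y in nhds x. integral {x - 1..y} (?g t) = dt f t y - dt f t (x - 1)"
      by eventually_elim (use eq in auto)
  qed
  moreover have "((\<lambda>y. dt f t y - dt f t (x - 1)) has_real_derivative dx (dt f) t x) (at x)"
    using DERIV_diff[OF smooth2_has_dx[OF smooth2_dt[OF f] t] DERIV_const] by simp
  ultimately show ?thesis by (rule DERIV_unique[rotated])
qed

section \<open>Periodicity in space and rules of differentiation\<close>

definition periodic2 :: "(real \<Rightarrow> real \<Rightarrow> real) \<Rightarrow> bool" where
  "periodic2 f \<longleftrightarrow> (\<forall>t>0. \<forall>x. f t (x + 2 * pi) = f t x)"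

lemma periodic2_dx:
  assumes "periodic2 f"
  shows "periodic2 (dx f)"
  unfolding periodic2_def
proof (intro allI impI)
  fix t x :: real assume "t > 0"
  then have "(\<lambda>y. f t (y + 2 * pi)) = f t" using assms by (auto simp: periodic2_def)
  moreover have "(f t has_real_derivative D) (at (x + 2 * pi)) \<longleftrightarrow>
      ((\<lambda>y. f t (y + 2 * pi)) has_real_derivative D) (at x)" for D
    by (rule DERIV_shift)
  ultimately show "dx f t (x + 2 * pi) = dx f t x"
    by (simp add: dx_def deriv_def)
qed

lemma periodic2_dt:
  assumes "periodic2 f"
  shows "periodic2 (dt f)"
  unfolding periodic2_def
proof (intro allI impI)
  fix t x :: real assume t: "t > 0"
  show "dt f t (x + 2 * pi) = dt f t x"
    unfolding dt_def
    by (rule deriv_cong_ev[OF eventually_nhds_pos[OF t] refl]) (use assms in \<open>auto simp: periodic2_def\<close>)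
qed

lemma integral_dx_periodic:
  assumes "smooth2 f" "periodic2 f" "t > 0"
  shows "integral {0..2 * pi} (dx f t) = 0"
proof -
  have "f t (0 + 2 * pi) = f t 0" using assms unfolding periodic2_def by blast
  then show ?thesis using smooth2_FTC[OF assms(1,3), of 0 "2 * pi"] by simp
qed

lemma dt_cong: "(\<And>t x. t > 0 \<Longrightarrow> f t x = g t x) \<Longrightarrow> t > 0 \<Longrightarrow> dt f t x = dt g t x"
  unfolding dt_def by (rule deriv_cong_ev[OF eventually_nhds_pos refl])

lemma dx_cong: "(\<And>t x. t > 0 \<Longrightarrow> f t x = g t x) \<Longrightarrow> t > 0 \<Longrightarrow> dx f t x = dx g t x"
  unfolding dx_def by (rule deriv_cong_ev[OF always_eventually refl]) simp

lemma dx_minus_scale: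
  assumes "smooth2 f" "t > 0"
  shows "dx (\<lambda>t x. - f t x) t x = - dx f t x"
    and "dx (\<lambda>t x. c * f t x) t x = c * dx f t x"
  using smooth2_has_dx[OF assms, of x]
  by (auto simp: dx_def intro!: DERIV_imp_deriv derivative_eq_intros)

lemma dx_rules:
  assumes "smooth2 f" "smooth2 g" "t > 0"
  shows "dx (\<lambda>t x. f t x + g t x) t x = dx f t x + dx g t x"
    and "dx (\<lambda>t x. f t x - g t x) t x = dx f t x - dx g t x"
    and "dx (\<lambda>t x. f t x * g t x) t x = dx f t x * g t x + f t x * dx g t x"
  using smooth2_has_dx[OF assms(1,3), of x] smooth2_has_dx[OF assms(2,3), of x]
  by (auto simp: dx_def intro!: DERIV_imp_deriv derivative_eq_intros)

lemma dt_minus_scale: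
  assumes "smooth2 f" "t > 0"
  shows "dt (\<lambda>t x. - f t x) t x = - dt f t x"
    and "dt (\<lambda>t x. c * f t x) t x = c * dt f t x"
  using smooth2_has_dt[OF assms, of x]
  by (auto simp: dt_def intro!: DERIV_imp_deriv derivative_eq_intros)

lemma dt_rules:
  assumes "smooth2 f" "smooth2 g" "t > 0"
  shows "dt (\<lambda>t x. f t x + g t x) t x = dt f t x + dt g t x"
    and "dt (\<lambda>t x. f t x - g t x) t x = dt f t x - dt g t x"
    and "dt (\<lambda>t x. f t x * g t x) t x = dt f t x * g t x + f t x * dt g t x"
  using smooth2_has_dt[OF assms(1,3), of x] smooth2_has_dt[OF assms(2,3), of x]
  by (auto simp: dt_def intro!: DERIV_imp_deriv derivative_eq_intros)

lemma dx_const: "dx (\<lambda>t x. c) t x = 0" and dt_const: "dt (\<lambda>t x. c) t x = 0"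
  by (simp_all add: dx_def dt_def)

subsection \<open>Evolving closed plane curves\<close>

locale curve_evolution =
  fixes X Y :: "real \<Rightarrow> real \<Rightarrow> real"
  assumes smooth_X [smooth_intros]: "smooth2 X" and smooth_Y [smooth_intros]: "smooth2 Y"
    and periodic_X: "periodic2 X" and periodic_Y: "periodic2 Y"
    and regular: "t > 0 \<Longrightarrow> (dx X t x)\<^sup>2 + (dx Y t x)\<^sup>2 > 0"
begin

text \<open>
  \<open>J\<close> is the speed, \<open>(P, Q)\<close> the unit tangent, \<open>(-Q, P)\<close> the unit normal, \<open>k\<close> the scalar curvature,
  \<open>\<phi>\<close> and \<open>V\<close> are the tangential and the normal velocity, and \<open>\<omega>\<close> is the time derivative of the
  tangent angle. No assumption is made on the tangential velocity.
\<close>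

definition J :: "real \<Rightarrow> real \<Rightarrow> real" where
  "J t x = sqrt ((dx X t x)\<^sup>2 + (dx Y t x)\<^sup>2)"

definition ds :: "(real \<Rightarrow> real \<Rightarrow> real) \<Rightarrow> real \<Rightarrow> real \<Rightarrow> real" where
  "ds f t x = dx f t x / J t x"

definition P :: "real \<Rightarrow> real \<Rightarrow> real" where "P t x = dx X t x / J t x"
definition Q :: "real \<Rightarrow> real \<Rightarrow> real" where "Q t x = dx Y t x / J t x"
definition k :: "real \<Rightarrow> real \<Rightarrow> real" where
  "k t x = (P t x * dx Q t x - Q t x * dx P t x) / J t x"
definition w :: "real \<Rightarrow> real \<Rightarrow> real" where
  "w t x = ds (ds k) t x + 1/2 * (k t x * k t x * k t x)"
definition V :: "real \<Rightarrow> real \<Rightarrow> real" where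
  "V t x = P t x * dt Y t x - Q t x * dt X t x"
definition \<phi> :: "real \<Rightarrow> real \<Rightarrow> real" where
  "\<phi> t x = P t x * dt X t x + Q t x * dt Y t x"
definition \<omega> :: "real \<Rightarrow> real \<Rightarrow> real" where
  "\<omega> t x = P t x * dt Q t x - Q t x * dt P t x"

lemma J_pos: "t > 0 \<Longrightarrow> J t x > 0"
  using regular by (simp add: J_def)

lemma J_nz: "t > 0 \<Longrightarrow> J t x \<noteq> 0"
  using J_pos[of t x] by simp

lemma smooth_J [smooth_intros]: "smooth2 J"
  unfolding J_def[abs_def] by (intro smooth2_sqrt smooth_intros regular)

lemma smooth_ds [smooth_intros]: "smooth2 f \<Longrightarrow> smooth2 (ds f)"
  unfolding ds_def[abs_def] by (intro smooth_intros J_nz)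

lemma smooth_P [smooth_intros]: "smooth2 P"
  unfolding P_def[abs_def] by (intro smooth_intros J_nz)

lemma smooth_Q [smooth_intros]: "smooth2 Q"
  unfolding Q_def[abs_def] by (intro smooth_intros J_nz)

lemma smooth_k [smooth_intros]: "smooth2 k"
  unfolding k_def[abs_def] by (intro smooth_intros J_nz)

lemma smooth_w [smooth_intros]: "smooth2 w"
  unfolding w_def[abs_def] by (intro smooth_intros)

lemma smooth_V [smooth_intros]: "smooth2 V"
  unfolding V_def[abs_def] by (intro smooth_intros)

lemma smooth_\<phi> [smooth_intros]: "smooth2 \<phi>"
  unfolding \<phi>_def[abs_def] by (intro smooth_intros)

lemma smooth_\<omega> [smooth_intros]: "smooth2 \<omega>"
  unfolding \<omega>_def[abs_def] by (intro smooth_intros)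

lemma periodic_J: "periodic2 J"
  using periodic2_dx[OF periodic_X] periodic2_dx[OF periodic_Y] by (simp add: periodic2_def J_def)

lemma periodic_ds: "periodic2 f \<Longrightarrow> periodic2 (ds f)"
  using periodic2_dx[of f] periodic_J by (simp add: periodic2_def ds_def)

lemma periodic_PQ: "periodic2 P" "periodic2 Q"
  using periodic2_dx[OF periodic_X] periodic2_dx[OF periodic_Y] periodic_J
  by (simp_all add: periodic2_def P_def Q_def)

lemma periodic_k: "periodic2 k"
  using periodic_PQ periodic_J periodic_PQ[THEN periodic2_dx] by (simp add: periodic2_def k_def)

lemma periodic_w: "periodic2 w"
  using periodic_ds[OF periodic_ds[OF periodic_k]] periodic_k by (simp add: periodic2_def w_def)

lemma periodic_V: "periodic2 V"
  using periodic_PQ periodic2_dt[OF periodic_X] periodic2_dt[OF periodic_Y]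
  by (simp add: periodic2_def V_def)

lemma periodic_\<phi>: "periodic2 \<phi>"
  using periodic_PQ periodic2_dt[OF periodic_X] periodic2_dt[OF periodic_Y]
  by (simp add: periodic2_def \<phi>_def)

lemmas smooths = smooth_X smooth_Y smooth_J smooth_P smooth_Q smooth_k smooth_w smooth_V smooth_\<phi> smooth_\<omega>
  smooth2_dx smooth2_dt smooth_ds

section \<open>Equations of the moving frame and first variations\<close>

lemma dx_ds: "t > 0 \<Longrightarrow> dx f t x = J t x * ds f t x"
  using J_nz by (simp add: ds_def)

lemma dx_X: "t > 0 \<Longrightarrow> dx X t x = J t x * P t x"
  and dx_Y: "t > 0 \<Longrightarrow> dx Y t x = J t x * Q t x"
  using J_nz by (simp_all add: P_def Q_def)

lemma PQ_unit:
  assumes t: "t > 0"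
  shows "P t x * P t x + Q t x * Q t x = 1"
proof -
  have sq: "(dx X t x)\<^sup>2 + (dx Y t x)\<^sup>2 = (J t x)\<^sup>2" by (simp add: J_def)
  have "P t x * P t x + Q t x * Q t x = ((dx X t x)\<^sup>2 + (dx Y t x)\<^sup>2) / (J t x)\<^sup>2"
    by (simp add: P_def Q_def power2_eq_square add_divide_distrib)
  also have "\<dots> = 1"
    unfolding sq using J_nz[OF t, of x] by simp
  finally show ?thesis .
qed

lemma PQ_orth:
  assumes t: "t > 0"
  shows "P t x * dx P t x + Q t x * dx Q t x = 0" "P t x * dt P t x + Q t x * dt Q t x = 0"
proof -
  have "dx (\<lambda>t x. P t x * P t x + Q t x * Q t x) t x = dx (\<lambda>t x. 1) t x"
    by (rule dx_cong[OF PQ_unit t])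
  then show "P t x * dx P t x + Q t x * dx Q t x = 0"
    by (simp add: dx_rules[OF _ _ t] dx_minus_scale[OF _ t] smooths smooth_intros dx_const)
  have "dt (\<lambda>t x. P t x * P t x + Q t x * Q t x) t x = dt (\<lambda>t x. 1) t x"
    by (rule dt_cong[OF PQ_unit t])
  then show "P t x * dt P t x + Q t x * dt Q t x = 0"
    by (simp add: dt_rules[OF _ _ t] dt_minus_scale[OF _ t] smooths smooth_intros dt_const)
qed

lemma Jk: "t > 0 \<Longrightarrow> J t x * k t x = P t x * dx Q t x - Q t x * dx P t x"
  using J_nz by (simp add: k_def)

text \<open>The Frenet equations and their analogues in time: the derivative of a unit vector is
  orthogonal to it, hence a multiple of the normal.\<close>

lemma dx_P: "t > 0 \<Longrightarrow> dx P t x = - (J t x * k t x * Q t x)"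
  and dx_Q: "t > 0 \<Longrightarrow> dx Q t x = J t x * k t x * P t x"
  and dt_P: "t > 0 \<Longrightarrow> dt P t x = - (\<omega> t x * Q t x)"
  and dt_Q: "t > 0 \<Longrightarrow> dt Q t x = \<omega> t x * P t x"
  using PQ_unit[of t x] PQ_orth[of t x] Jk[of t x] unfolding \<omega>_def by algebra+

lemma dt_X: "t > 0 \<Longrightarrow> dt X t x = \<phi> t x * P t x - V t x * Q t x"
  and dt_Y: "t > 0 \<Longrightarrow> dt Y t x = \<phi> t x * Q t x + V t x * P t x"
  using PQ_unit[of t x] unfolding \<phi>_def V_def by algebra+

text \<open>Tangential and normal components of the symmetry of mixed derivatives of the curve,
  whose space derivative is \<open>J\<close> times the tangent and whose time derivative is split
  into \<open>\<phi>\<close> and \<open>V\<close>.\<close>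

lemma velocity_components:
  assumes t: "t > 0"
  shows "dt J t x = dx \<phi> t x - V t x * J t x * k t x"
    and "J t x * \<omega> t x = \<phi> t x * J t x * k t x + dx V t x"
proof -
  have X: "dt J t x * P t x + J t x * dt P t x =
      dx \<phi> t x * P t x + \<phi> t x * dx P t x - (dx V t x * Q t x + V t x * dx Q t x)"
  proof -
    have "dt (dx X) t x = dt (\<lambda>t x. J t x * P t x) t x"
      by (rule dt_cong[OF dx_X t])
    moreover have "dx (dt X) t x = dx (\<lambda>t x. \<phi> t x * P t x - V t x * Q t x) t x"
      by (rule dx_cong[OF dt_X t])
    ultimately show ?thesis
      using dx_dt_commute[OF smooth_X t, of x]
      by (simp add: dx_rules[OF _ _ t] dx_minus_scale[OF _ t] dt_rules[OF _ _ t] dt_minus_scale[OF _ t] smooths smooth_intros)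
  qed
  have Y: "dt J t x * Q t x + J t x * dt Q t x =
      dx \<phi> t x * Q t x + \<phi> t x * dx Q t x + (dx V t x * P t x + V t x * dx P t x)"
  proof -
    have "dt (dx Y) t x = dt (\<lambda>t x. J t x * Q t x) t x"
      by (rule dt_cong[OF dx_Y t])
    moreover have "dx (dt Y) t x = dx (\<lambda>t x. \<phi> t x * Q t x + V t x * P t x) t x"
      by (rule dx_cong[OF dt_Y t])
    ultimately show ?thesis
      using dx_dt_commute[OF smooth_Y t, of x]
      by (simp add: dx_rules[OF _ _ t] dx_minus_scale[OF _ t] dt_rules[OF _ _ t] dt_minus_scale[OF _ t] smooths smooth_intros)
  qed
  show "dt J t x = dx \<phi> t x - V t x * J t x * k t x"
    using X Y PQ_unit[OF t, of x] dx_P[OF t, of x] dx_Q[OF t, of x] dt_P[OF t, of x] dt_Q[OF t, of x]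
    by algebra
  show "J t x * \<omega> t x = \<phi> t x * J t x * k t x + dx V t x"
    using X Y PQ_unit[OF t, of x] dx_P[OF t, of x] dx_Q[OF t, of x] dt_P[OF t, of x] dt_Q[OF t, of x]
    by algebra
qed

text \<open>\<open>J k\<close> and \<open>\<omega>\<close> are the space and time derivatives of the
  tangent angle, so this is the symmetry of its mixed derivatives, obtained from the tangent vector
  without choosing an angle.\<close>

lemma dt_Jk:
  assumes t: "t > 0"
  shows "dt J t x * k t x + J t x * dt k t x = dx \<omega> t x"
proof -
  have "dt (\<lambda>t x. J t x * k t x) t x = dt (\<lambda>t x. P t x * dx Q t x - Q t x * dx P t x) t x"
    by (rule dt_cong[OF Jk t])
  then have 1: "dt J t x * k t x + J t x * dt k t x =
     dt P t x * dx Q t x + P t x * dt (dx Q) t x - (dt Q t x * dx P t x + Q t x * dt (dx P) t x)"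
    by (simp add: dt_rules[OF _ _ t] dt_minus_scale[OF _ t] smooths smooth_intros)
  have "dx (dt P) t x = dx (\<lambda>t x. - (\<omega> t x * Q t x)) t x"
    by (rule dx_cong[OF dt_P t])
  then have 2: "dt (dx P) t x = - (dx \<omega> t x * Q t x + \<omega> t x * dx Q t x)"
    using dx_dt_commute[OF smooth_P t, of x]
    by (simp add: dx_rules[OF _ _ t] dx_minus_scale[OF _ t] smooths smooth_intros)
  have "dx (dt Q) t x = dx (\<lambda>t x. \<omega> t x * P t x) t x"
    by (rule dx_cong[OF dt_Q t])
  then have 3: "dt (dx Q) t x = dx \<omega> t x * P t x + \<omega> t x * dx P t x"
    using dx_dt_commute[OF smooth_Q t, of x]
    by (simp add: dx_rules[OF _ _ t] dx_minus_scale[OF _ t] smooths smooth_intros)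
  show ?thesis
    using 1 2 3 PQ_unit[OF t, of x] PQ_orth[OF t, of x] dt_P[OF t, of x] dt_Q[OF t, of x]
    by algebra
qed

lemma \<omega>_eq: "t > 0 \<Longrightarrow> \<omega> t x = \<phi> t x * k t x + ds V t x"
  using velocity_components(2)[of t x] J_nz[of t x] by (simp add: ds_def field_simps)

text \<open>The curvature evolves by \<open>V_ss + k^2 V + \<phi> k_s\<close>. Two integrations by
  parts move the derivatives from \<open>V\<close> to \<open>k\<close> and leave
  \<open>2 w V\<close> plus an exact derivative; the tangential motion enters only through the exact
  term.\<close>

lemma dt_energy_density:
  assumes t: "t > 0"
  shows "dt (\<lambda>t x. k t x * k t x * J t x) t x =
    dx (\<lambda>t x. k t x * k t x * \<phi> t x + 2 * (k t x * ds V t x) - 2 * (ds k t x * V t x)) t x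
    + 2 * (w t x * V t x * J t x)"
proof -
  have om: "dx \<omega> t x = dx (\<lambda>t x. \<phi> t x * k t x + ds V t x) t x"
    by (rule dx_cong[OF \<omega>_eq t])
  then have om: "dx \<omega> t x = dx \<phi> t x * k t x + \<phi> t x * dx k t x + dx (ds V) t x"
    by (simp add: dx_rules[OF _ _ t] dx_minus_scale[OF _ t] smooths smooth_intros dx_const)
  have "dt (\<lambda>t x. k t x * k t x * J t x) t x
      = (dt k t x * k t x + k t x * dt k t x) * J t x + k t x * k t x * dt J t x"
    by (simp add: dt_rules[OF _ _ t] dt_minus_scale[OF _ t] smooths smooth_intros dx_const)
  moreover have "dx (\<lambda>t x. k t x * k t x * \<phi> t x + 2 * (k t x * ds V t x) - 2 * (ds k t x * V t x)) t x
     = (dx k t x * k t x + k t x * dx k t x) * \<phi> t x + k t x * k t x * dx \<phi> t x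
       + 2 * (dx k t x * ds V t x + k t x * dx (ds V) t x)
       - 2 * (dx (ds k) t x * V t x + ds k t x * dx V t x)"
    by (simp add: dx_rules[OF _ _ t] dx_minus_scale[OF _ t] smooths smooth_intros dx_const)
  moreover have "w t x = ds (ds k) t x + 1/2 * (k t x * k t x * k t x)"
    by (simp add: w_def)
  ultimately show ?thesis
    using om dt_Jk[OF t, of x] velocity_components(1)[OF t, of x]
      dx_ds[OF t, of V x] dx_ds[OF t, of k x] dx_ds[OF t, of "ds k" x]
    by algebra
qed

text \<open>First variation of area: by symmetry of mixed derivatives, everything but the normal
  velocity is an exact derivative.\<close>

lemma dt_area_density:
  assumes t: "t > 0"
  shows "dt (\<lambda>t x. Y t x * dx X t x - X t x * dx Y t x) t x =
    dx (\<lambda>t x. Y t x * dt X t x - X t x * dt Y t x) t x + 2 * (V t x * J t x)"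
proof -
  have "dt (\<lambda>t x. Y t x * dx X t x - X t x * dx Y t x) t x =
     dt Y t x * dx X t x + Y t x * dt (dx X) t x - (dt X t x * dx Y t x + X t x * dt (dx Y) t x)"
    by (simp add: dt_rules[OF _ _ t] dt_minus_scale[OF _ t] smooths smooth_intros dx_const)
  moreover have "dx (\<lambda>t x. Y t x * dt X t x - X t x * dt Y t x) t x =
     dx Y t x * dt X t x + Y t x * dx (dt X) t x - (dx X t x * dt Y t x + X t x * dx (dt Y) t x)"
    by (simp add: dx_rules[OF _ _ t] dx_minus_scale[OF _ t] smooths smooth_intros dx_const)
  ultimately show ?thesis
    using dx_dt_commute[OF smooth_X t, of x] dx_dt_commute[OF smooth_Y t, of x] dx_X[OF t, of x] dx_Y[OF t, of x]
    unfolding V_def by algebra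
qed

end

subsection \<open>Energy estimates\<close>

lemma deriv_has_integral:
  fixes F :: "real \<Rightarrow> real"
  assumes "\<And>x. (F has_real_derivative F' x) (at x)" "a \<le> b"
  shows "(F' has_integral F b - F a) {a..b}"
  by (rule fundamental_theorem_of_calculus[OF assms(2)
      has_vector_derivative_at_within[OF has_real_derivative_iff_has_vector_derivative[THEN iffD1]]])
     (rule assms(1))

text \<open>The continuous majorant \<open>g\<close> takes the place of
  \<open>\<bar>F'\<bar>\<close>; in the applications it is the speed or a smooth quadratic
  expression.\<close>

lemma deviation_bound:
  fixes F :: "real \<Rightarrow> real"
  assumes F: "\<And>x. (F has_real_derivative F' x) (at x)"
    and bound: "\<And>x. \<bar>F' x\<bar> \<le> g x" and g: "continuous_on UNIV g" and x: "a \<le> x" "x \<le> b"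
  shows "\<bar>F x - F a\<bar> \<le> integral {a..b} g"
proof -
  have int: "g integrable_on {c..d}" for c d
    using g by (intro integrable_continuous_real) (rule continuous_on_subset, auto)
  have "\<bar>F x - F a\<bar> = norm (integral {a..x} F')"
    using integral_unique[OF deriv_has_integral[OF F x(1)]] by simp
  also have "\<dots> \<le> integral {a..x} g"
    by (rule integral_norm_bound_integral)
       (use bound int has_integral_integrable[OF deriv_has_integral[OF F x(1)]] in auto)
  also have "\<dots> \<le> integral {a..b} g"
    by (rule integral_subset_le) (use x int order_trans[OF abs_ge_zero bound] in auto)
  finally show ?thesis .
qed

text \<open>A pointwise substitute for the Cauchy-Schwarz inequality under the integral, with a
  weight to be tuned.\<close>

lemma amgm_weighted:
  fixes a M :: real
  assumes "M > 0"
  shows "\<bar>a\<bar> \<le> M / 2 * a\<^sup>2 + 1 / (2 * M)"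
proof -
  have "0 \<le> (M * \<bar>a\<bar> - 1)\<^sup>2" by simp
  then have "2 * M * \<bar>a\<bar> \<le> M\<^sup>2 * a\<^sup>2 + 1"
    by (simp add: power2_diff power_mult_distrib)
  then show ?thesis
    using assms by (simp add: field_simps power2_eq_square)
qed

section \<open>Estimates for a single closed curve\<close>

context curve_evolution
begin

definition len :: "real \<Rightarrow> real" where "len t = integral {0..2 * pi} (J t)"
text \<open>This is \<open>2 E\<close> for the elastic energy E, which explains the factors 2 in the
  variation formulas.\<close>

definition bending :: "real \<Rightarrow> real" where
  "bending t = integral {0..2 * pi} (\<lambda>x. k t x * k t x * J t x)"
definition dissipation :: "real \<Rightarrow> real" where
  "dissipation t = integral {0..2 * pi} (\<lambda>x. ds w t x * ds w t x * J t x)"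
text \<open>Equal to -2 times the signed area, by \<open>signed_area_curve\<close>.\<close>

definition area2 :: "real \<Rightarrow> real" where
  "area2 t = integral {0..2 * pi} (\<lambda>x. Y t x * dx X t x - X t x * dx Y t x)"

lemma slice_integrable: "smooth2 f \<Longrightarrow> t > 0 \<Longrightarrow> (\<lambda>x. f t x) integrable_on {a..b}"
  using smooth2_integrable by simp

lemma bending_nonneg: "t > 0 \<Longrightarrow> bending t \<ge> 0"
  unfolding bending_def
  by (intro integral_nonneg slice_integrable[of "\<lambda>t x. k t x * k t x * J t x"] smooth_intros)
     (auto simp: less_imp_le J_pos)

text \<open>A continuous nonnegative function with zero integral vanishes, but \<open>J\<close> is
  positive.\<close>

lemma len_pos:
  assumes t: "t > 0"
  shows "len t > 0"
proof -
  have "len t \<ge> 0"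
    unfolding len_def using smooth2_integrable[OF smooth_J t] J_pos[OF t]
    by (intro integral_nonneg) (auto simp: less_imp_le)
  moreover have "len t \<noteq> 0"
  proof
    assume "len t = 0"
    then have "(J t has_integral 0) (cbox 0 (2 * pi))"
      using smooth2_integrable[OF smooth_J t, of 0 "2 * pi"] by (simp add: len_def has_integral_iff)
    then have "J t 0 = 0"
      by (rule has_integral_0_cbox_imp_0[rotated 2])
         (use smooth2_continuous_slice[OF smooth_J t] J_pos[OF t] in \<open>auto simp: less_imp_le linorder_not_le[THEN iffD2, OF pi_gt_zero]\<close>)
    then show False using J_pos[OF t, of 0] by simp
  qed
  ultimately show ?thesis by simp
qed

lemma J_has_integral: "t > 0 \<Longrightarrow> (J t has_integral len t) {0..2 * pi}"
  unfolding len_def by (intro integrable_integral smooth2_integrable smooth_intros)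

lemma bending_has_integral:
  "t > 0 \<Longrightarrow> ((\<lambda>x. k t x * k t x * J t x) has_integral bending t) {0..2 * pi}"
  unfolding bending_def
  by (intro integrable_integral slice_integrable[of "\<lambda>t x. k t x * k t x * J t x"] smooth_intros)

lemma dissipation_has_integral:
  "t > 0 \<Longrightarrow> ((\<lambda>x. ds w t x * ds w t x * J t x) has_integral dissipation t) {0..2 * pi}"
  unfolding dissipation_def
  by (intro integrable_integral slice_integrable[of "\<lambda>t x. ds w t x * ds w t x * J t x"] smooth_intros)

lemma dx_has_integral:
  "smooth2 f \<Longrightarrow> periodic2 f \<Longrightarrow> t > 0 \<Longrightarrow> (dx f t has_integral 0) {0..2 * pi}"
  by (simp add: has_integral_iff integral_dx_periodic smooth2_integrable smooths)

lemmas dx_X_has_integral = dx_has_integral[OF smooth_X periodic_X]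
  and dx_Y_has_integral = dx_has_integral[OF smooth_Y periodic_Y]

text \<open>Since the tangent has mean zero, it must turn by at least a right angle.\<close>

lemma bending_lower_bound:
  assumes t: "t > 0" and M: "len t < M"
  shows "1 / M \<le> bending t"
proof -
  have Mpos: "M > 0" using len_pos[OF t] M by simp
  \<comment> \<open>By the weighted inequality, \<open>R\<close> dominates the total absolute
    curvature.\<close>
  define R where "R = integral {0..2 * pi} (\<lambda>x. (M / 2 * (k t x)\<^sup>2 + 1 / (2 * M)) * J t x)"
  define c d where "c = P t 0" and "d = Q t 0"
  have cd: "c * c + d * d = 1" unfolding c_def d_def by (rule PQ_unit[OF t])
  \<comment> \<open>\<open>?F\<close> is minus the cosine of the angle between the tangents at
    \<open>x\<close> and at 0; the last factor of \<open>?F'\<close> is the corresponding sine, up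
    to sign.\<close>
  let ?F = "\<lambda>x. - (P t x * c + Q t x * d)"
  let ?F' = "\<lambda>x. J t x * k t x * (Q t x * c - P t x * d)"
  have F: "(?F has_real_derivative ?F' x) (at x)" for x
    using smooth2_has_dx[OF smooth_P t, of x] smooth2_has_dx[OF smooth_Q t, of x]
    by (auto simp: dx_P[OF t] dx_Q[OF t] algebra_simps intro!: derivative_eq_intros)
  have F': "\<bar>?F' x\<bar> \<le> (M / 2 * (k t x)\<^sup>2 + 1 / (2 * M)) * J t x" for x
  proof -
    have "(Q t x * c - P t x * d)\<^sup>2 + (P t x * c + Q t x * d)\<^sup>2 = 1"
      using PQ_unit[OF t, of x] cd by algebra
    then have "(Q t x * c - P t x * d)\<^sup>2 \<le> 1"
      using zero_le_power2[of "P t x * c + Q t x * d"] by linarith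
    then have "\<bar>Q t x * c - P t x * d\<bar> \<le> 1" by (simp add: abs_square_le_1)
    then have "\<bar>?F' x\<bar> \<le> J t x * \<bar>k t x\<bar> * 1"
      unfolding abs_mult using J_pos[OF t, of x] by (intro mult_mono) auto
    also have "\<dots> \<le> J t x * (M / 2 * (k t x)\<^sup>2 + 1 / (2 * M))"
      using amgm_weighted[OF Mpos, of "k t x"] J_pos[OF t, of x] by simp
    finally show ?thesis by (simp add: mult.commute)
  qed
  have sm: "smooth2 (\<lambda>t x. (M / 2 * (k t x)\<^sup>2 + 1 / (2 * M)) * J t x)"
    by (intro smooth_intros)
  have dev: "1 - (P t x * c + Q t x * d) \<le> R" if "0 \<le> x" "x \<le> 2 * pi" for x
    using deviation_bound[OF F F' smooth2_continuous_slice[OF sm t] that] cd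
    unfolding R_def c_def d_def by (simp add: algebra_simps)
  \<comment> \<open>The bound on 1 minus the cosine is integrated over arc length; the cosine has
    integral zero because the curve closes up.\<close>
  have "integral {0..2 * pi} (\<lambda>x. J t x - (c * dx X t x + d * dx Y t x)) \<le> integral {0..2 * pi} (\<lambda>x. R * J t x)"
  proof (rule integral_le)
    show "(\<lambda>x. J t x - (c * dx X t x + d * dx Y t x)) integrable_on {0..2 * pi}"
      by (rule slice_integrable[of "\<lambda>t x. J t x - (c * dx X t x + d * dx Y t x)", OF _ t]) (intro smooth_intros)
    show "(\<lambda>x. R * J t x) integrable_on {0..2 * pi}"
      by (rule slice_integrable[of "\<lambda>t x. R * J t x", OF _ t]) (intro smooth_intros)
    show "J t x - (c * dx X t x + d * dx Y t x) \<le> R * J t x" if "x \<in> {0..2 * pi}" for x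
      using mult_right_mono[OF dev[of x], of "J t x"] that J_pos[OF t, of x]
      by (simp add: dx_X[OF t] dx_Y[OF t] algebra_simps)
  qed
  also have "integral {0..2 * pi} (\<lambda>x. J t x - (c * dx X t x + d * dx Y t x)) = len t"
  proof -
    have "((\<lambda>x. J t x - (c * dx X t x + d * dx Y t x)) has_integral len t - (c * 0 + d * 0)) {0..2 * pi}"
      by (intro has_integral_diff has_integral_add has_integral_mult_right J_has_integral
          dx_X_has_integral dx_Y_has_integral t)
    then show ?thesis by (simp add: integral_unique)
  qed
  finally have "len t \<le> R * len t" by (simp add: len_def)
  then have R1: "1 \<le> R" using len_pos[OF t] by simp
  have "R = integral {0..2 * pi} (\<lambda>x. M / 2 * (k t x * k t x * J t x) + 1 / (2 * M) * J t x)"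
    unfolding R_def by (simp add: algebra_simps power2_eq_square)
  also have "\<dots> = M / 2 * bending t + 1 / (2 * M) * len t"
    by (intro integral_unique has_integral_add has_integral_mult_right bending_has_integral J_has_integral t)
  \<comment> \<open>The weight \<open>M\<close> was chosen so that the length term is at most half
    of the lower bound 1 for \<open>R\<close>.\<close>
  also have "\<dots> \<le> M / 2 * bending t + 1 / 2"
    using M Mpos by (simp add: field_simps)
  finally show ?thesis using R1 Mpos by (simp add: field_simps)
qed

text \<open>The first variation of the bending energy under dilations centred at \<open>(c, d)\<close>.\<close>

lemma scaling_identity:
  assumes t: "t > 0"
  shows "((\<lambda>x. 2 * w t x * (P t x * (Y t x - d) - Q t x * (X t x - c)) * J t x + k t x * k t x * J t x)
           has_integral 0) {0..2 * pi}"
proof -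
  \<comment> \<open>\<open>?n\<close> and \<open>?\<tau>\<close> are the normal and tangential
    components of the position relative to \<open>(c, d)\<close>. As \<open>?n\<close> has
    arc-length derivative \<open>- k ?\<tau>\<close>, the antiderivative \<open>?H\<close> is minus
    the flux of \<open>dt_energy_density\<close> with \<open>V = ?n\<close> and
    \<open>\<phi> = ?\<tau>\<close>.\<close>
  let ?n = "\<lambda>x. P t x * (Y t x - d) - Q t x * (X t x - c)"
  let ?\<tau> = "\<lambda>x. P t x * (X t x - c) + Q t x * (Y t x - d)"
  let ?H = "\<lambda>x. 2 * ds k t x * ?n x + k t x * k t x * ?\<tau> x"
  let ?f = "\<lambda>x. 2 * w t x * ?n x * J t x + k t x * k t x * J t x"
  note D = smooth2_has_dx[OF smooth_X t] smooth2_has_dx[OF smooth_Y t] smooth2_has_dx[OF smooth_P t]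
    smooth2_has_dx[OF smooth_Q t] smooth2_has_dx[OF smooth_k t] smooth2_has_dx[OF smooth_ds[OF smooth_k] t]
  have "(?H has_real_derivative ?f x) (at x)" for x
  proof -
    define n' where "n' = dx P t x * (Y t x - d) + P t x * dx Y t x - (dx Q t x * (X t x - c) + Q t x * dx X t x)"
    define \<tau>' where "\<tau>' = dx P t x * (X t x - c) + P t x * dx X t x + (dx Q t x * (Y t x - d) + Q t x * dx Y t x)"
    have n: "(?n has_real_derivative n') (at x)"
      unfolding n'_def by (auto intro!: derivative_eq_intros D)
    have \<tau>: "(?\<tau> has_real_derivative \<tau>') (at x)"
      unfolding \<tau>'_def by (auto intro!: derivative_eq_intros D)
    have n': "n' = - (k t x * ?\<tau> x * J t x)"
      unfolding n'_def dx_X[OF t] dx_Y[OF t] dx_P[OF t] dx_Q[OF t] by algebra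
    have \<tau>': "\<tau>' = J t x + k t x * ?n x * J t x"
      unfolding \<tau>'_def dx_X[OF t] dx_Y[OF t] dx_P[OF t] dx_Q[OF t]
      using PQ_unit[OF t, of x] by algebra
    have "(?H has_real_derivative (2 * dx (ds k) t x * ?n x + 2 * ds k t x * n')
        + ((dx k t x * k t x + k t x * dx k t x) * ?\<tau> x + k t x * k t x * \<tau>')) (at x)"
      by (rule derivative_eq_intros n \<tau> D refl | simp)+
    moreover have "(2 * dx (ds k) t x * ?n x + 2 * ds k t x * n')
        + ((dx k t x * k t x + k t x * dx k t x) * ?\<tau> x + k t x * k t x * \<tau>') = ?f x"
      unfolding n' \<tau>' dx_ds[OF t] w_def by algebra
    ultimately show ?thesis by simp
  qed
  from deriv_has_integral[OF this, of 0 "2 * pi"]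
  have "(?f has_integral ?H (2 * pi) - ?H 0) {0..2 * pi}" by simp
  moreover have per: "f t (2 * pi) = f t 0" if "periodic2 f" for f
  proof -
    have "f t (0 + 2 * pi) = f t 0" using that t unfolding periodic2_def by blast
    then show ?thesis by simp
  qed
  ultimately show ?thesis
    by (simp only: per[OF periodic_X] per[OF periodic_Y] per[OF periodic_k] per[OF periodic_PQ(1)]
        per[OF periodic_PQ(2)] per[OF periodic_ds[OF periodic_k]] diff_self)
qed

text \<open>The oscillation of \<open>w\<close> controls \<open>bending\<close> through the scaling
  identity and is itself controlled by the dissipation; \<open>bending_lower_bound\<close> then
  keeps the latter away from zero.\<close>

lemma dissipation_lower_bound:
  assumes t: "t > 0" and M: "len t < M" and area: "area2 t = 0"
  shows "1 / (16 * M ^ 7) \<le> dissipation t"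
proof -
  define L where "L = len t"
  have L: "0 < L" "L < M" using len_pos[OF t] M by (auto simp: L_def)
  then have Mpos: "M > 0" by simp
  \<comment> \<open>Centring the dilation at a point of the curve bounds each relative coordinate by
    the length.\<close>
  define c d where "c = X t 0" and "d = Y t 0"
  let ?n = "\<lambda>x. P t x * (Y t x - d) - Q t x * (X t x - c)"
  \<comment> \<open>This weight makes the constant term of the final estimate,
    \<open>4 * (1 / (2 * \<epsilon>)) * M * M\<^sup>2\<close>, equal to \<open>1 / (2 * M)\<close>,
    half of the lower bound \<open>1 / M\<close> that has to absorb it.\<close>
  define \<epsilon> where "\<epsilon> = 4 * M ^ 4"
  have \<epsilon>: "\<epsilon> > 0" using Mpos by (simp add: \<epsilon>_def)
  define R where "R = integral {0..2 * pi} (\<lambda>x. (\<epsilon> / 2 * (ds w t x)\<^sup>2 + 1 / (2 * \<epsilon>)) * J t x)"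
  have smR: "smooth2 (\<lambda>t x. (\<epsilon> / 2 * (ds w t x)\<^sup>2 + 1 / (2 * \<epsilon>)) * J t x)"
    by (intro smooth_intros)
  have R: "R = \<epsilon> / 2 * dissipation t + 1 / (2 * \<epsilon>) * L"
  proof -
    have "R = integral {0..2 * pi} (\<lambda>x. \<epsilon> / 2 * (ds w t x * ds w t x * J t x) + 1 / (2 * \<epsilon>) * J t x)"
      unfolding R_def by (simp add: algebra_simps power2_eq_square)
    also have "\<dots> = \<epsilon> / 2 * dissipation t + 1 / (2 * \<epsilon>) * L"
      unfolding L_def
      by (intro integral_unique has_integral_add has_integral_mult_right dissipation_has_integral J_has_integral t)
    finally show ?thesis .
  qed
  have R0: "R \<ge> 0"
    unfolding R_def using J_pos[OF t] \<epsilon>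
    by (intro integral_nonneg slice_integrable[OF smR t]) (auto simp: less_imp_le)
  have wdev: "\<bar>w t x - w t 0\<bar> \<le> R" if "0 \<le> x" "x \<le> 2 * pi" for x
    unfolding R_def
  proof (rule deviation_bound[OF smooth2_has_dx[OF smooth_w t] _ smooth2_continuous_slice[OF smR t] that])
    show "\<bar>dx w t x\<bar> \<le> (\<epsilon> / 2 * (ds w t x)\<^sup>2 + 1 / (2 * \<epsilon>)) * J t x" for x
      using mult_left_mono[OF amgm_weighted[OF \<epsilon>, of "ds w t x"], of "J t x"] J_pos[OF t, of x]
      by (simp add: dx_ds[OF t] abs_mult mult.commute)
  qed
  have P1: "\<bar>P t x\<bar> \<le> 1" and Q1: "\<bar>Q t x\<bar> \<le> 1" for x
    using PQ_unit[OF t, of x] unfolding abs_square_le_1[symmetric] power2_eq_square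
    by (smt (verit) zero_le_square)+
  have Xdev: "\<bar>X t x - c\<bar> \<le> L" if "0 \<le> x" "x \<le> 2 * pi" for x
    unfolding L_def len_def c_def
  proof (rule deviation_bound[OF smooth2_has_dx[OF smooth_X t] _ smooth2_continuous_slice[OF smooth_J t] that])
    show "\<bar>dx X t x\<bar> \<le> J t x" for x
      using P1[of x] J_pos[OF t, of x] by (simp add: dx_X[OF t] abs_mult)
  qed
  have Ydev: "\<bar>Y t x - d\<bar> \<le> L" if "0 \<le> x" "x \<le> 2 * pi" for x
    unfolding L_def len_def d_def
  proof (rule deviation_bound[OF smooth2_has_dx[OF smooth_Y t] _ smooth2_continuous_slice[OF smooth_J t] that])
    show "\<bar>dx Y t x\<bar> \<le> J t x" for x
      using Q1[of x] J_pos[OF t, of x] by (simp add: dx_Y[OF t] abs_mult)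
  qed
  have ndev: "\<bar>?n x\<bar> \<le> 2 * L" if x: "0 \<le> x" "x \<le> 2 * pi" for x
  proof -
    have "\<bar>P t x * (Y t x - d)\<bar> \<le> 1 * L" "\<bar>Q t x * (X t x - c)\<bar> \<le> 1 * L"
      unfolding abs_mult by (intro mult_mono P1 Q1 Xdev Ydev x abs_ge_zero zero_le_one)+
    then show ?thesis by linarith
  qed
  \<comment> \<open>The integrand differs from the area density by a combination of
    \<open>dx X\<close> and \<open>dx Y\<close>, which have integral zero; here the vanishing area
    enters.\<close>
  have nJ: "((\<lambda>x. ?n x * J t x) has_integral 0) {0..2 * pi}"
  proof -
    have smA: "smooth2 (\<lambda>t x. Y t x * dx X t x - X t x * dx Y t x)" by (intro smooth_intros)
    have "((\<lambda>x. Y t x * dx X t x - X t x * dx Y t x) has_integral 0) {0..2 * pi}"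
      using slice_integrable[OF smA t] area by (simp add: area2_def has_integral_iff)
    then have "((\<lambda>x. (Y t x * dx X t x - X t x * dx Y t x) + (c * dx Y t x - d * dx X t x))
        has_integral 0 + (c * 0 - d * 0)) {0..2 * pi}"
      by (intro has_integral_add has_integral_diff has_integral_mult_right
          dx_X_has_integral dx_Y_has_integral t)
    then show ?thesis
      by (simp add: dx_X[OF t] dx_Y[OF t] algebra_simps)
  qed
  \<comment> \<open>Since \<open>?n\<close> has mean zero with respect to arc length, the constant
    \<open>w t 0\<close> may be subtracted from \<open>w\<close> in the scaling identity.\<close>
  have "((\<lambda>x. (2 * w t x * ?n x * J t x + k t x * k t x * J t x) - k t x * k t x * J t x
      - 2 * w t 0 * (?n x * J t x)) has_integral (0 - bending t - 2 * w t 0 * 0)) {0..2 * pi}"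
    by (intro has_integral_diff has_integral_mult_right scaling_identity bending_has_integral nJ t)
  then have I: "((\<lambda>x. 2 * (w t x - w t 0) * ?n x * J t x) has_integral - bending t) {0..2 * pi}"
    by (simp add: algebra_simps)
  have bound: "norm (2 * (w t x - w t 0) * ?n x * J t x) \<le> (4 * R * L) * J t x" if "x \<in> {0..2 * pi}" for x
  proof -
    have "\<bar>w t x - w t 0\<bar> * \<bar>?n x\<bar> \<le> R * (2 * L)"
      using wdev[of x] ndev[of x] that R0 by (intro mult_mono) auto
    then have "\<bar>w t x - w t 0\<bar> * \<bar>?n x\<bar> * (2 * J t x) \<le> R * (2 * L) * (2 * J t x)"
      using J_pos[OF t, of x] by (intro mult_right_mono) auto
    moreover have "norm (2 * (w t x - w t 0) * ?n x * J t x) = \<bar>w t x - w t 0\<bar> * \<bar>?n x\<bar> * (2 * J t x)"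
      using J_pos[OF t, of x] by (simp only: real_norm_def abs_mult abs_of_pos)
    ultimately show ?thesis by simp
  qed
  have "bending t = norm (integral {0..2 * pi} (\<lambda>x. 2 * (w t x - w t 0) * ?n x * J t x))"
    using integral_unique[OF I] bending_nonneg[OF t] by simp
  also have "\<dots> \<le> integral {0..2 * pi} (\<lambda>x. (4 * R * L) * J t x)"
    by (rule integral_norm_bound_integral[OF has_integral_integrable[OF I]
          has_integral_integrable[OF has_integral_mult_right[OF J_has_integral[OF t]]] bound])
  also have "\<dots> = 4 * R * L * L" by (simp add: L_def len_def)
  finally have "1 / M \<le> 4 * R * L\<^sup>2"
    using bending_lower_bound[OF t M] by (simp add: power2_eq_square)
  also have "\<dots> \<le> 4 * R * M\<^sup>2"
    using L R0 by (intro mult_left_mono power_mono) auto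
  also have "\<dots> \<le> 4 * (\<epsilon> / 2 * dissipation t + 1 / (2 * \<epsilon>) * M) * M\<^sup>2"
    using L \<epsilon> unfolding R by (simp add: divide_right_mono)
  also have "\<dots> = 8 * M ^ 6 * dissipation t + 1 / (2 * M)"
    using Mpos unfolding \<epsilon>_def by (simp add: field_simps power_numeral_reduce)
  finally have "1 / (2 * M) \<le> 8 * M ^ 6 * dissipation t"
    using Mpos by (simp add: field_simps)
  then have "1 / (2 * M) / (8 * M ^ 6) \<le> dissipation t"
    using Mpos by (subst pos_divide_le_eq) (simp_all add: mult_ac)
  also have "1 / (2 * M) / (8 * M ^ 6) = 1 / (16 * M ^ 7)"
    by (simp add: power_numeral_reduce)
  finally show ?thesis .
qed

end

section \<open>Energy dissipation and area conservation along the flow\<close>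

locale elastic_flow = curve_evolution +
  assumes flow: "t > 0 \<Longrightarrow> V t x = ds (ds w) t x"
begin

text \<open>With \<open>V = w_ss\<close>, another integration by parts turns \<open>2 w V\<close>
  into \<open>- 2 w_s^2\<close>. All exact terms are collected in the periodic flux
  \<open>?G\<close>, whose derivative integrates to zero.\<close>

lemma bending_deriv:
  assumes t: "t > 0"
  shows "(bending has_real_derivative - 2 * dissipation t) (at t)"
proof -
  let ?e = "\<lambda>t x. k t x * k t x * J t x"
  let ?G = "\<lambda>t x. (k t x * k t x * \<phi> t x + 2 * (k t x * ds V t x) - 2 * (ds k t x * V t x)) + 2 * (w t x * ds w t x)"
  have se: "smooth2 ?e" and sG: "smooth2 ?G"
    by (intro smooth_intros)+
  have pG: "periodic2 ?G"
    using periodic_k periodic_\<phi> periodic_V periodic_w periodic_ds[OF periodic_k] periodic_ds[OF periodic_V]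
      periodic_ds[OF periodic_w] by (simp add: periodic2_def)
  have e: "dt ?e t x = dx ?G t x - 2 * (ds w t x * ds w t x * J t x)" for x
  proof -
    have "dx ?G t x = dx (\<lambda>t x. k t x * k t x * \<phi> t x + 2 * (k t x * ds V t x) - 2 * (ds k t x * V t x)) t x
       + dx (\<lambda>t x. 2 * (w t x * ds w t x)) t x"
      by (intro dx_rules smooth_intros t)
    moreover have "dx (\<lambda>t x. 2 * (w t x * ds w t x)) t x = 2 * (dx w t x * ds w t x + w t x * dx (ds w) t x)"
      by (simp add: dx_rules[OF _ _ t] smooths smooth_intros dx_const)
    ultimately show ?thesis
      using dt_energy_density[OF t, of x] flow[OF t, of x] dx_ds[OF t, of w x] dx_ds[OF t, of "ds w" x]
      by (simp add: algebra_simps)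
  qed
  have "(\<lambda>x. dx ?G t x - 2 * (ds w t x * ds w t x * J t x)) = dt ?e t"
    using e by auto
  moreover have "((\<lambda>x. dx ?G t x - 2 * (ds w t x * ds w t x * J t x)) has_integral 0 - 2 * dissipation t) {0..2 * pi}"
    by (intro has_integral_diff has_integral_mult_right dx_has_integral[OF sG pG] dissipation_has_integral t)
  ultimately have "(dt ?e t has_integral 0 - 2 * dissipation t) {0..2 * pi}"
    by (simp only:)
  then have "integral {0..2 * pi} (dt ?e t) = - 2 * dissipation t"
    by (simp only: integral_unique)
  then show ?thesis
    using smooth2_integral_has_dt[OF se t, of 0 "2 * pi"] unfolding bending_def[abs_def] by simp
qed

text \<open>The normal velocity is an arc-length derivative of the periodic function
  \<open>ds w\<close>, so its integral over the curve vanishes.\<close>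

lemma area2_deriv:
  assumes t: "t > 0"
  shows "(area2 has_real_derivative 0) (at t)"
proof -
  let ?a = "\<lambda>t x. Y t x * dx X t x - X t x * dx Y t x"
  let ?G = "\<lambda>t x. (Y t x * dt X t x - X t x * dt Y t x) + 2 * ds w t x"
  have sa: "smooth2 ?a" and sG: "smooth2 ?G" by (intro smooth_intros)+
  have pG: "periodic2 ?G"
    using periodic_X periodic_Y periodic_X[THEN periodic2_dt] periodic_Y[THEN periodic2_dt]
      periodic_ds[OF periodic_w] by (simp add: periodic2_def)
  have "dt ?a t x = dx ?G t x" for x
  proof -
    have "dx ?G t x = dx (\<lambda>t x. Y t x * dt X t x - X t x * dt Y t x) t x + dx (\<lambda>t x. 2 * ds w t x) t x"
      by (intro dx_rules smooth_intros t)
    moreover have "dx (\<lambda>t x. 2 * ds w t x) t x = 2 * dx (ds w) t x"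
      by (intro dx_minus_scale smooth_intros t)
    ultimately show ?thesis
      using dt_area_density[OF t, of x] flow[OF t, of x] dx_ds[OF t, of "ds w" x]
      by (simp add: algebra_simps)
  qed
  then have "dt ?a t = dx ?G t" by auto
  then show ?thesis
    using smooth2_integral_has_dt[OF sa t, of 0 "2 * pi"] integral_dx_periodic[OF sG pG t]
    unfolding area2_def[abs_def] by simp
qed

text \<open>The area enters as a right limit because \<open>smooth2\<close> says nothing at time 0;
  being constant for positive times, it then vanishes there.\<close>

lemma len_unbounded:
  assumes area: "(area2 \<longlongrightarrow> 0) (at_right 0)"
  shows "\<exists>t>0. len t \<ge> M"
proof (rule ccontr)
  assume "\<not> (\<exists>t>0. len t \<ge> M)"
  then have M: "len t < M" if "t > 0" for t using that by (meson not_le)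
  then have Mpos: "M > 0" using len_pos[of 1] by (meson less_trans zero_less_one)
  have area0: "area2 t = 0" if "t > 0" for t
  proof -
    have "area2 s = area2 t" if "s > 0" for s
    proof -
      have "\<exists>c. \<forall>s\<in>{0<..}. area2 s = c"
        by (rule has_field_derivative_zero_constant)
           (auto intro: has_field_derivative_at_within area2_deriv)
      then show ?thesis using that \<open>t > 0\<close> by auto
    qed
    then have "eventually (\<lambda>s. area2 s = area2 t) (at_right 0)"
      by (auto simp: eventually_at_filter)
    then have "(area2 \<longlongrightarrow> area2 t) (at_right 0)"
      by (rule tendsto_eventually)
    with area show ?thesis
      by (metis tendsto_unique trivial_limit_at_right_real)
  qed
  \<comment> \<open>Twice the lower bound of the dissipation, matching the derivative
    \<open>- 2 * dissipation\<close> of \<open>bending\<close>.\<close>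
  define c where "c = 2 * (1 / (16 * M ^ 7))"
  have c: "c > 0" using Mpos by (simp add: c_def)
  have decr: "bending t + c * t \<le> bending 1 + c * 1" if "1 \<le> t" for t
  proof (rule DERIV_nonpos_imp_nonincreasing[OF that])
    fix s :: real assume "1 \<le> s"
    then have s: "s > 0" by simp
    have "((\<lambda>s. bending s + c * s) has_real_derivative - 2 * dissipation s + c) (at s)"
      by (auto intro!: derivative_eq_intros bending_deriv s)
    moreover have "- 2 * dissipation s + c \<le> 0"
      using dissipation_lower_bound[OF s M[OF s] area0[OF s]] by (simp add: c_def)
    ultimately show "\<exists>y. ((\<lambda>s. bending s + c * s) has_real_derivative y) (at s) \<and> y \<le> 0" by blast
  qed
  \<comment> \<open>At this time the linear upper bound for \<open>bending\<close> equals
    \<open>- c\<close>.\<close>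
  let ?t = "bending 1 / c + 2"
  have "?t \<ge> 1" using bending_nonneg[of 1] c by simp
  from decr[OF this] have "bending ?t \<le> bending 1 + c - c * ?t" by simp
  also have "\<dots> < 0" using c by (simp add: field_simps)
  finally show False using bending_nonneg[of ?t] \<open>?t \<ge> 1\<close> by linarith
qed

end

subsection \<open>Vector-valued formulation\<close>

lemma vector2_eq: "(vector [a, b] :: real^2) = a *\<^sub>R axis 1 1 + b *\<^sub>R axis 2 1"
  by (simp add: vec_eq_iff forall_2 axis_def)

lemma has_vector_derivative_vector2:
  assumes "(f has_real_derivative a) (at x)" "(g has_real_derivative b) (at x)"
  shows "((\<lambda>x. vector [f x, g x] :: real^2) has_vector_derivative vector [a, b]) (at x)"
proof -
  have "((\<lambda>x. f x *\<^sub>R (axis 1 1 :: real^2) + g x *\<^sub>R axis 2 1) has_vector_derivative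
      a *\<^sub>R axis 1 1 + b *\<^sub>R axis 2 1) (at x)"
    using has_vector_derivative_add[OF has_vector_derivative_scaleR[OF assms(1) has_vector_derivative_const]
        has_vector_derivative_scaleR[OF assms(2) has_vector_derivative_const]] by simp
  then show ?thesis by (simp only: vector2_eq)
qed

lemma norm_vector2: "norm (vector [a, b] :: real^2) = sqrt (a\<^sup>2 + b\<^sup>2)"
  by (simp add: norm_vec_def L2_set_def sum_2)

lemma inner_vector2: "(vector [a, b] :: real^2) \<bullet> vector [c, d] = a * c + b * d"
  by (simp add: inner_vec_def sum_2)

lemma arith_vector2:
  "(vector [a, b] :: real^2) + vector [c, d] = vector [a + c, b + d]"
  "(vector [a, b] :: real^2) - vector [c, d] = vector [a - c, b - d]"
  "r *\<^sub>R (vector [a, b] :: real^2) = vector [r * a, r * b]"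
  by (simp_all add: vec_eq_iff forall_2)

text \<open>The speed cancels the normalization of the normal; where the derivative vanishes, both
  integrands are zero.\<close>

lemma signed_area_eq:
  "signed_area c = - (1/2) * integral {0..2 * pi}
     (\<lambda>x. c x $ 2 * vector_derivative c (at x) $ 1 - c x $ 1 * vector_derivative c (at x) $ 2)"
proof -
  have "(c x \<bullet> unit_normal c x) * speed c x =
      c x $ 2 * vector_derivative c (at x) $ 1 - c x $ 1 * vector_derivative c (at x) $ 2" for x
    by (cases "vector_derivative c (at x) = 0")
       (simp_all add: unit_normal_def rot90_def tangent_def arc_deriv_def speed_def inner_vec_def sum_2 field_simps)
  then show ?thesis by (simp add: signed_area_def)
qed

text \<open>Chain rule for a path inside \<open>S\<close>, so that a Frechet derivative taken within
  \<open>S\<close> suffices.\<close>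

lemma has_vector_derivative_along:
  assumes F: "F differentiable_on S" and g: "(g has_vector_derivative v) (at s within A)"
    and "g ` A \<subseteq> S" "s \<in> A"
  shows "((\<lambda>r. F (g r)) has_vector_derivative frechet_derivative F (at (g s) within S) v) (at s within A)"
proof -
  let ?D = "frechet_derivative F (at (g s) within S)"
  have D: "(F has_derivative ?D) (at (g s) within S)"
    using F assms(3,4) by (auto simp: differentiable_on_def frechet_derivative_works)
  have "((\<lambda>r. F (g r)) has_derivative (\<lambda>h. ?D (h *\<^sub>R v))) (at s within A)"
    by (rule has_derivative_in_compose[OF g[unfolded has_vector_derivative_def]
          has_derivative_subset[OF D assms(3)]])
  moreover have "?D (h *\<^sub>R v) = h *\<^sub>R ?D v" for h
    using has_derivative_linear[OF D] by (rule linear_cmul)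
  ultimately show ?thesis by (simp add: has_vector_derivative_def)
qed

section \<open>Partial derivatives on the closed half plane\<close>

abbreviation (input) spacetime :: "(real \<times> real) set" where "spacetime \<equiv> {0..} \<times> UNIV"

text \<open>Lines of constant time stay in the half plane even at \<open>t = 0\<close>, so the space
  derivative is two-sided there as well, in contrast to the time derivative.\<close>

lemma has_dx_spacetime:
  assumes "F differentiable_on spacetime" "t \<ge> 0"
  shows "((\<lambda>x. F (t, x)) has_vector_derivative frechet_derivative F (at (t, x) within spacetime) (0, 1)) (at x)"
proof -
  have "((\<lambda>x. (t, x)) has_vector_derivative (0, 1)) (at x)"
    by (auto intro!: derivative_eq_intros has_vector_derivative_Pair)
  from has_vector_derivative_along[OF assms(1) this] assms(2) show ?thesis by auto
qed

lemma has_dt_spacetime: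
  assumes "F differentiable_on spacetime" "t > 0"
  shows "((\<lambda>t. F (t, x)) has_vector_derivative frechet_derivative F (at (t, x) within spacetime) (1, 0)) (at t)"
proof -
  have "((\<lambda>t. (t, x)) has_vector_derivative (1, 0)) (at t within {0<..})"
    by (auto intro!: derivative_eq_intros has_vector_derivative_Pair)
  moreover have "(\<lambda>t. (t, x)) ` {0<..} \<subseteq> spacetime" by auto
  ultimately have "((\<lambda>t. F (t, x)) has_vector_derivative
      frechet_derivative F (at (t, x) within spacetime) (1, 0)) (at t within {0<..})"
    using assms by (intro has_vector_derivative_along) auto
  then show ?thesis
    using assms(2) at_within_open[of t "{0<..}"] by simp
qed

text \<open>The Frechet derivative in the directions \<open>(1, 0)\<close> and \<open>(0, 1)\<close>
  yields the partial derivatives, and the induction hypothesis applies to these directional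
  derivatives.\<close>

lemma Ck_on_imp_Ck2:
  fixes F :: "real \<times> real \<Rightarrow> real^2"
  assumes "Ck_on n spacetime F"
  shows "Ck2 n (\<lambda>t x. F (t, x) $ i)"
  using assms
proof (induction n arbitrary: F)
  case 0
  then have "continuous_on ({0<..} \<times> UNIV) F"
    by (auto intro: continuous_on_subset)
  then show ?case by (auto simp: case_prod_unfold intro!: continuous_intros)
next
  case (Suc n)
  let ?D = "\<lambda>v p. frechet_derivative F (at p within spacetime) v"
  from Suc.prems have F: "F differentiable_on spacetime" and D: "Ck_on n spacetime (?D v)" for v
    unfolding Ck_on.simps(2) by blast+
  have "continuous_on ({0<..} \<times> UNIV) F"
    by (rule continuous_on_subset[OF differentiable_imp_continuous_on[OF F]]) auto
  then have c: "continuous_on ({0<..} \<times> UNIV) (\<lambda>(t, x). F (t, x) $ i)"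
    by (auto simp: case_prod_unfold intro!: continuous_intros)
  have p: "has_partials (\<lambda>t x. F (t, x) $ i) (\<lambda>t x. ?D (1, 0) (t, x) $ i) (\<lambda>t x. ?D (0, 1) (t, x) $ i)"
    using bounded_linear.has_vector_derivative[OF bounded_linear_vec_nth has_dt_spacetime[OF F]]
      bounded_linear.has_vector_derivative[OF bounded_linear_vec_nth has_dx_spacetime[OF F]]
    by (intro has_partialsI) (simp_all add: has_real_derivative_iff_has_vector_derivative)
  show ?case
    unfolding Ck2.simps(2)
    by (intro conjI c exI[of _ "\<lambda>t x. ?D (1, 0) (t, x) $ i"] exI[of _ "\<lambda>t x. ?D (0, 1) (t, x) $ i"] p
        Suc.IH D)
qed

text \<open>Continuity up to \<open>t = 0\<close> is what hands the zero area of the initial curve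
  on to positive times.\<close>

lemma signed_area_continuous:
  fixes \<gamma> :: "real \<Rightarrow> real \<Rightarrow> real^2"
  assumes "Ck_on 2 spacetime (\<lambda>(t, x). \<gamma> t x)"
  shows "continuous_on {0..} (\<lambda>t. signed_area (\<gamma> t))"
proof -
  let ?F = "\<lambda>(t, x). \<gamma> t x"
  define G where "G = (\<lambda>p. frechet_derivative ?F (at p within spacetime) (0, 1))"
  have F: "?F differentiable_on spacetime" and G: "continuous_on spacetime G"
    using assms differentiable_imp_continuous_on by (auto simp: numeral_2_eq_2 G_def)
  have cF: "continuous_on spacetime ?F"
    by (rule differentiable_imp_continuous_on[OF F])
  have vd: "vector_derivative (\<gamma> t) (at x) = G (t, x)" if "t \<ge> 0" for t x
    using vector_derivative_at[OF has_dx_spacetime[OF F that]] by (simp add: G_def)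
  have "continuous_on ({0..} \<times> cbox 0 (2 * pi)) (\<lambda>p. ?F p $ 2 * G p $ 1 - ?F p $ 1 * G p $ 2)"
    by (intro continuous_intros continuous_on_subset[OF cF] continuous_on_subset[OF G]) auto
  then have "continuous_on ({0..} \<times> cbox 0 (2 * pi))
      (\<lambda>(t, x). \<gamma> t x $ 2 * G (t, x) $ 1 - \<gamma> t x $ 1 * G (t, x) $ 2)"
    by (simp add: case_prod_unfold)
  from integral_continuous_on_param[OF this]
  have "continuous_on {0..} (\<lambda>t. - (1/2) * integral {0..2 * pi}
      (\<lambda>x. \<gamma> t x $ 2 * G (t, x) $ 1 - \<gamma> t x $ 1 * G (t, x) $ 2))"
    by (intro continuous_intros) simp
  then show ?thesis
    by (rule continuous_on_eq) (simp add: signed_area_eq vd)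
qed

section \<open>The geometric operators in scalar form\<close>

context curve_evolution
begin

definition curve :: "real \<Rightarrow> real \<Rightarrow> real^2" where
  "curve t x = vector [X t x, Y t x]"

text \<open>The multiple of the unit normal \<open>(-Q, P)\<close> by \<open>h\<close>; normal
  fields are handled through this scalar factor.\<close>

definition normal_field :: "(real \<Rightarrow> real \<Rightarrow> real) \<Rightarrow> real \<Rightarrow> real \<Rightarrow> real^2" where
  "normal_field h t x = vector [- (h t x * Q t x), h t x * P t x]"

lemma vector_derivative_curve:
  "t > 0 \<Longrightarrow> vector_derivative (curve t) (at x) = vector [dx X t x, dx Y t x]"
  unfolding curve_def[abs_def]
  by (intro vector_derivative_at has_vector_derivative_vector2 smooth2_has_dx smooth_intros)

lemma speed_curve: "t > 0 \<Longrightarrow> speed (curve t) x = J t x"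
  by (simp add: speed_def vector_derivative_curve norm_vector2 J_def)

lemma curve_length_curve: "t > 0 \<Longrightarrow> curve_length (curve t) = len t"
  unfolding curve_length_def len_def using speed_curve[of t] by (simp cong: integral_cong)

lemma signed_area_curve: "t > 0 \<Longrightarrow> signed_area (curve t) = - (1/2) * area2 t"
  by (simp add: signed_area_eq vector_derivative_curve area2_def) (simp add: curve_def)

lemma arc_deriv_vector2:
  assumes "smooth2 f" "smooth2 g" "t > 0"
  shows "arc_deriv (curve t) (\<lambda>x. vector [f t x, g t x]) x = vector [ds f t x, ds g t x]"
proof -
  have "vector_derivative (\<lambda>x. vector [f t x, g t x] :: real^2) (at x) = vector [dx f t x, dx g t x]"
    by (intro vector_derivative_at has_vector_derivative_vector2 smooth2_has_dx assms)
  then show ?thesis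
    by (simp add: arc_deriv_def speed_curve assms(3) arith_vector2 ds_def divide_inverse mult.commute)
qed

lemma tangent_curve:
  assumes "t > 0"
  shows "tangent (curve t) = (\<lambda>x. vector [P t x, Q t x])"
proof
  fix x
  have "tangent (curve t) x = arc_deriv (curve t) (\<lambda>x. vector [X t x, Y t x]) x"
    by (simp only: tangent_def curve_def[abs_def])
  also have "\<dots> = vector [P t x, Q t x]"
    by (simp only: arc_deriv_vector2[OF smooth_X smooth_Y assms] ds_def P_def Q_def)
  finally show "tangent (curve t) x = vector [P t x, Q t x]" .
qed

lemma normal_proj_curve:
  assumes "t > 0"
  shows "normal_proj (curve t) (\<lambda>x. vector [f t x, g t x]) x =
    normal_field (\<lambda>t x. P t x * g t x - Q t x * f t x) t x"
proof -
  have "f t x - (f t x * P t x + g t x * Q t x) * P t x = - ((P t x * g t x - Q t x * f t x) * Q t x)"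
    "g t x - (f t x * P t x + g t x * Q t x) * Q t x = (P t x * g t x - Q t x * f t x) * P t x"
    using PQ_unit[OF assms, of x] by algebra+
  then show ?thesis
    by (simp only: normal_proj_def tangent_curve[OF assms] inner_vector2 arith_vector2 normal_field_def)
qed

lemma ds_PQ:
  assumes "t > 0"
  shows "ds P t x = - (k t x * Q t x)" "ds Q t x = k t x * P t x"
  using dx_P[OF assms, of x] dx_Q[OF assms, of x] J_nz[OF assms] by (simp_all add: ds_def)

lemma curvature_curve: "t > 0 \<Longrightarrow> curvature (curve t) = normal_field k t"
  unfolding curvature_def
  by (rule ext) (simp add: tangent_curve[unfolded tangent_def] arc_deriv_vector2 smooths ds_PQ normal_field_def)

text \<open>By the Frenet equations, differentiating the normal gives a tangential vector, which the
  projection removes; only the scalar factor is differentiated.\<close>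

lemma nabla_normal_field:
  assumes h: "smooth2 h" and t: "t > 0"
  shows "nabla_s (curve t) (normal_field h t) = normal_field (ds h) t"
proof
  fix x
  have sm: "smooth2 (\<lambda>t x. - (h t x * Q t x))" "smooth2 (\<lambda>t x. h t x * P t x)"
    by (intro smooth_intros h)+
  have d': "dx (\<lambda>t x. - (h t x * Q t x)) t x = - (dx h t x * Q t x + h t x * dx Q t x)"
    "dx (\<lambda>t x. h t x * P t x) t x = dx h t x * P t x + h t x * dx P t x"
    by (simp_all add: dx_rules[OF _ _ t] dx_minus_scale[OF _ t] h smooths smooth_intros)
  have d: "ds (\<lambda>t x. - (h t x * Q t x)) t x = - (ds h t x * Q t x + h t x * ds Q t x)"
    "ds (\<lambda>t x. h t x * P t x) t x = ds h t x * P t x + h t x * ds P t x"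
    using J_nz[OF t, of x] unfolding ds_def d' by (simp_all add: field_simps)
  have "arc_deriv (curve t) (normal_field h t) =
      (\<lambda>x. vector [ds (\<lambda>t x. - (h t x * Q t x)) t x, ds (\<lambda>t x. h t x * P t x) t x])"
    unfolding normal_field_def[abs_def] using arc_deriv_vector2[OF sm t] by auto
  then have "nabla_s (curve t) (normal_field h t) x =
      normal_field (\<lambda>t x. P t x * ds (\<lambda>t x. h t x * P t x) t x - Q t x * ds (\<lambda>t x. - (h t x * Q t x)) t x) t x"
    by (simp only: nabla_s_def normal_proj_curve[OF t])
  moreover have "P t x * ds (\<lambda>t x. h t x * P t x) t x - Q t x * ds (\<lambda>t x. - (h t x * Q t x)) t x = ds h t x"
    unfolding d ds_PQ[OF t] using PQ_unit[OF t, of x] by algebra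
  ultimately show "nabla_s (curve t) (normal_field h t) x = normal_field (ds h) t x"
    by (simp only: normal_field_def)
qed

lemma nabla2_normal_field:
  "smooth2 h \<Longrightarrow> t > 0 \<Longrightarrow> (nabla_s (curve t) ^^ 2) (normal_field h t) = normal_field (ds (ds h)) t"
  by (simp add: numeral_2_eq_2 nabla_normal_field smooth_ds)

lemma norm_normal_field: "t > 0 \<Longrightarrow> (norm (normal_field h t x))\<^sup>2 = (h t x)\<^sup>2"
proof -
  assume t: "t > 0"
  have "(norm (normal_field h t x))\<^sup>2 = (h t x * Q t x)\<^sup>2 + (h t x * P t x)\<^sup>2"
    by (simp add: normal_field_def norm_vector2)
  also have "\<dots> = (h t x)\<^sup>2"
    using PQ_unit[OF t, of x] by algebra
  finally show ?thesis .
qed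

lemma elastic_gradient_curve:
  assumes t: "t > 0"
  shows "(nabla_s (curve t) ^^ 2) (curvature (curve t)) x
      + (1/2) *\<^sub>R (norm (curvature (curve t) x))\<^sup>2 *\<^sub>R curvature (curve t) x = normal_field w t x"
  unfolding curvature_curve[OF t] nabla2_normal_field[OF smooth_k t] norm_normal_field[OF t]
  by (simp add: normal_field_def arith_vector2 w_def power2_eq_square algebra_simps)

lemma normal_velocity_curve: "t > 0 \<Longrightarrow> normal_velocity curve t x = normal_field V t x"
proof -
  assume t: "t > 0"
  have "vector_derivative (\<lambda>\<tau>. curve \<tau> x) (at t) = vector [dt X t x, dt Y t x]" for x
    unfolding curve_def
    by (intro vector_derivative_at has_vector_derivative_vector2 smooth2_has_dt smooth_intros t)
  then show ?thesis
    by (simp add: normal_velocity_def normal_proj_curve[OF t]) (simp add: normal_field_def V_def)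
qed

lemma normal_field_inject:
  assumes "t > 0" "normal_field f t x = normal_field g t x"
  shows "f t x = g t x"
proof -
  from assms(2) have "f t x * Q t x = g t x * Q t x" "f t x * P t x = g t x * P t x"
    by (auto simp: normal_field_def vec_eq_iff forall_2)
  then show ?thesis using PQ_unit[OF assms(1), of x] by algebra
qed

end

section \<open>Transfer to the vector-valued flow\<close>

theorem lemma6p10:
  fixes \<gamma>\<^sub>0 :: "real \<Rightarrow> real^2" and \<gamma> :: "real \<Rightarrow> real \<Rightarrow> real^2"
  assumes "closed_curve \<gamma>\<^sub>0" and "smooth_on UNIV \<gamma>\<^sub>0" and "regular_curve \<gamma>\<^sub>0"
    and "signed_area \<gamma>\<^sub>0 = 0"
    and "smooth_on ({0..} \<times> UNIV) (\<lambda>(t, x). \<gamma> t x)"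
    and "\<And>t. t \<ge> 0 \<Longrightarrow> closed_curve (\<gamma> t)"
    and "\<And>t. t \<ge> 0 \<Longrightarrow> regular_curve (\<gamma> t)"
    and "\<And>t x. t > 0 \<Longrightarrow> normal_velocity \<gamma> t x =
           (nabla_s (\<gamma> t) ^^ 2)
             (\<lambda>y. (nabla_s (\<gamma> t) ^^ 2) (curvature (\<gamma> t)) y
                  + (1/2) *\<^sub>R (norm (curvature (\<gamma> t) y))\<^sup>2 *\<^sub>R curvature (\<gamma> t) y) x"
    and "\<gamma> 0 = \<gamma>\<^sub>0"
  shows "\<not> (\<exists>M. \<forall>t\<ge>0. curve_length (\<gamma> t) < M)"
proof
  assume "\<exists>M. \<forall>t\<ge>0. curve_length (\<gamma> t) < M"
  then obtain M where M: "\<And>t. t \<ge> 0 \<Longrightarrow> curve_length (\<gamma> t) < M" by blast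
  define X Y where "X = (\<lambda>t x. \<gamma> t x $ 1)" and "Y = (\<lambda>t x. \<gamma> t x $ 2)"
  have Ck: "Ck_on n spacetime (\<lambda>(t, x). \<gamma> t x)" for n
    using assms(5) by (simp add: smooth_on_def)
  have smooth: "smooth2 X" "smooth2 Y"
    unfolding smooth2_def X_def Y_def using Ck_on_imp_Ck2[OF Ck] by simp_all
  have periodic: "periodic2 X" "periodic2 Y"
    using assms(6) unfolding periodic2_def closed_curve_def X_def Y_def by simp_all
  have \<gamma>: "\<gamma> = (\<lambda>t x. vector [X t x, Y t x])"
    by (simp add: fun_eq_iff X_def Y_def vec_eq_iff forall_2)
  interpret curve_evolution X Y
  proof
    fix t x :: real assume t: "t > 0"
    have "vector_derivative (\<gamma> t) (at x) = vector [dx X t x, dx Y t x]"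
      unfolding \<gamma> by (intro vector_derivative_at has_vector_derivative_vector2 smooth2_has_dx smooth t)
    then have "vector [dx X t x, dx Y t x] \<noteq> (0 :: real^2)"
      using assms(7)[of t] t by (auto simp: regular_curve_def)
    then show "(dx X t x)\<^sup>2 + (dx Y t x)\<^sup>2 > 0"
      by (auto simp: vec_eq_iff forall_2 sum_power2_gt_zero_iff)
  qed (fact smooth periodic)+
  have curve: "\<gamma> = curve"
    unfolding \<gamma> by (simp add: fun_eq_iff curve_def)
  interpret elastic_flow X Y
  proof
    fix t x :: real assume t: "t > 0"
    have "normal_field V t x = normal_field (ds (ds w)) t x"
      using assms(8)[OF t, of x, unfolded curve elastic_gradient_curve[OF t] normal_velocity_curve[OF t]]
      by (simp only: nabla2_normal_field[OF smooth_w t])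
    then show "V t x = ds (ds w) t x" by (rule normal_field_inject[OF t])
  qed
  have "((\<lambda>t. signed_area (\<gamma> t)) \<longlongrightarrow> signed_area (\<gamma> 0)) (at 0 within {0..})"
    using signed_area_continuous[OF Ck] by (simp add: continuous_on)
  \<comment> \<open>The factor -2 converts signed area to \<open>area2\<close>. The two are
    identified only for \<open>t > 0\<close>, which is enough for the right limit.\<close>
  then have "((\<lambda>t. - 2 * signed_area (\<gamma> t)) \<longlongrightarrow> - 2 * 0) (at 0 within {0<..})"
    using assms(4,9) by (intro tendsto_mult tendsto_const) (auto intro: tendsto_within_subset)
  then have "(area2 \<longlongrightarrow> 0) (at_right 0)"
    by (rule Lim_transform_eventually[THEN tendsto_eq_rhs])
       (auto simp: eventually_at_filter curve signed_area_curve)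
  from len_unbounded[OF this] obtain t where "t > 0" "len t \<ge> M" by blast
  then show False
    using M[of t] curve_length_curve[of t] by (simp add: curve)
qed

end
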